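(* Let $\mathcal{C}$ be a class of ontologies such that $\textsc{cert-eval}[\mathcal{C}]$ is decidable. Then $\textsc{cert-eval}[\mathsf{Dyadic}\text{-}\mathcal{C}]$ is decidable.
   Context: A TGD is $\sigma:\Phi(\mathbf{x},\mathbf{y})\to\exists\mathbf{z}\,\Psi(\mathbf{x},\mathbf{z})$ with body $\Phi$, head $\Psi$, existential variables $\mathrm{exvars}(\sigma)=\mathbf{z}$, frontier $\mathbf{x}$; an ontology is a finite set of TGDs. $\textsc{cert-eval}[\mathcal{C}]$: given a database $D$, $\Sigma\in\mathcal{C}$, a CQ $q(\mathbf{x})$ and constant tuple $\mathbf{c}$, decide whether $\mathbf{c}\in q(M)$ for every model $M\supseteq D$ of $\Sigma$. Affected positions: for existential variable $z$, a position $\pi$ is $z$-affected if some rule has $z$ in its head at $\pi$, or some rule has a frontier variable in its head at $\pi$ occurring in its body only at $z$-affected positions; $\mathrm{aff}(\pi)$ is the set of such $z$. A body variable at positions $\pi_1,\dots,\pi_n$ is harmless if $\bigcap_i\mathrm{aff}(\pi_i)=\emptyset$, harmful otherwise; a harmful frontier variable is dangerous. For $\sigma\in\Sigma$, a body atom is $\sigma$-problematic if it contains a dangerous variable or shares a harmful variable with a $\sigma$-problematic atom; $\mathrm{p\text{-}atoms}(\sigma)$ are these, $\mathrm{s\text{-}atoms}(\sigma)$ the rest. $\mathrm{HF}(\sigma)$ = harmless frontier variables in $\mathrm{s\text{-}atoms}(\sigma)$; $\mathrm{bridge}(\sigma)=(\mathrm{vars}(\mathrm{p\text{-}atoms}(\sigma))\cap\mathrm{vars}(\mathrm{s\text{-}atoms}(\sigma)))\cup\mathrm{HF}(\sigma)$.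 With a fresh predicate $\mathrm{Aux}_\sigma$: $\mathrm{main}(\sigma):\mathrm{Aux}_\sigma(\mathrm{bridge}(\sigma)),\mathrm{p\text{-}atoms}(\sigma)\to\exists\,\mathrm{exvars}(\sigma)\,\mathrm{head}(\sigma)$ and $\mathrm{main}(\Sigma)=\bigcup_{\sigma\in\Sigma}\mathrm{main}(\sigma)$. $\Sigma\in\mathsf{Dyadic}\text{-}\mathcal{C}$ iff $\Sigma\in\mathcal{C}$ or $\mathrm{main}(\Sigma)\in\mathcal{C}$. *)

theory Defs
  imports Main "HOL-Library.Nat_Bijection" "HOL-Library.List_Lexorder"
          "HOL-Library.Product_Lexorder"
begin

datatype recf = Zr | Sc | Proj nat | Cn recf "recf list" | Pr recf recf | Mn recf

inductive reval :: "recf \<Rightarrow> nat list \<Rightarrow> nat \<Rightarrow> bool" where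
  zr: "reval Zr xs 0"
| sc: "reval Sc (x # xs) (Suc x)"
| proj: "i < length xs \<Longrightarrow> reval (Proj i) xs (xs ! i)"
| cn: "length ys = length gs \<Longrightarrow> (\<forall>i<length gs. reval (gs ! i) xs (ys ! i))
       \<Longrightarrow> reval f ys z \<Longrightarrow> reval (Cn f gs) xs z"
| pr0: "reval f xs y \<Longrightarrow> reval (Pr f g) (0 # xs) y"
| prS: "reval (Pr f g) (n # xs) y \<Longrightarrow> reval g (y # n # xs) z
       \<Longrightarrow> reval (Pr f g) (Suc n # xs) z"
| mn: "reval f (n # xs) 0 \<Longrightarrow> (\<forall>m<n. \<exists>k. 0 < k \<and> reval f (m # xs) k)
       \<Longrightarrow> reval (Mn f) xs n"

definition decidable :: "nat set \<Rightarrow> bool" where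
  "decidable L \<longleftrightarrow> (\<exists>r. \<forall>n. reval r [n] (if n \<in> L then 1 else 0))"

text \<open>An atom is a predicate symbol with an argument list; in rules and
  queries the arguments are variables, in databases they are constants
  (both encoded as nat). A predicate is identified by name and arity.\<close>
type_synonym atom = "nat \<times> nat list"
type_synonym tgd = "atom set \<times> atom set"
type_synonym ontology = "tgd set"

definition avars :: "atom set \<Rightarrow> nat set" where
  "avars A = (\<Union>(p, xs)\<in>A. set xs)"

definition body :: "tgd \<Rightarrow> atom set" where "body \<sigma> = fst \<sigma>"
definition head :: "tgd \<Rightarrow> atom set" where "head \<sigma> = snd \<sigma>"

definition frontier :: "tgd \<Rightarrow> nat set" where
  "frontier \<sigma> = avars (body \<sigma>) \<inter> avars (head \<sigma>)"

definition exvars :: "tgd \<Rightarrow> nat set" where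
  "exvars \<sigma> = avars (head \<sigma>) - avars (body \<sigma>)"

datatype dterm = Cst nat | Nul nat

type_synonym dinst = "(nat \<times> dterm list) set"

definition sat_tgd :: "dinst \<Rightarrow> tgd \<Rightarrow> bool" where
  "sat_tgd M \<sigma> \<longleftrightarrow> (\<forall>g :: nat \<Rightarrow> dterm.
      (\<forall>(p, xs)\<in>body \<sigma>. (p, map g xs) \<in> M) \<longrightarrow>
      (\<exists>g'. (\<forall>x\<in>frontier \<sigma>. g' x = g x) \<and> (\<forall>(p, xs)\<in>head \<sigma>. (p, map g' xs) \<in> M)))"

definition models :: "dinst \<Rightarrow> ontology \<Rightarrow> bool" where
  "models M \<Sigma> \<longleftrightarrow> (\<forall>\<sigma>\<in>\<Sigma>. sat_tgd M \<sigma>)"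

definition db_inst :: "atom set \<Rightarrow> dinst" where
  "db_inst D = (\<lambda>(p, cs). (p, map Cst cs)) ` D"

type_synonym cq = "nat list \<times> atom set"

definition cq_ans :: "dinst \<Rightarrow> cq \<Rightarrow> nat list \<Rightarrow> bool" where
  "cq_ans M q c \<longleftrightarrow> (\<exists>g. (\<forall>(p, ys)\<in>snd q. (p, map g ys) \<in> M) \<and> map g (fst q) = map Cst c)"

definition certain :: "atom set \<Rightarrow> ontology \<Rightarrow> cq \<Rightarrow> nat list \<Rightarrow> bool" where
  "certain D \<Sigma> q c \<longleftrightarrow> (\<forall>M. db_inst D \<subseteq> M \<longrightarrow> models M \<Sigma> \<longrightarrow> cq_ans M q c)"

type_synonym pos = "nat \<times> nat \<times> nat"

definition posns :: "atom set \<Rightarrow> nat \<Rightarrow> pos set" where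
  "posns A x = {(p, length xs, i) | p xs i. (p, xs) \<in> A \<and> i < length xs \<and> xs ! i = x}"

text \<open>An existential variable is identified by its rule: (rule, variable).\<close>
inductive affected :: "ontology \<Rightarrow> tgd \<times> nat \<Rightarrow> pos \<Rightarrow> bool" for \<Sigma> where
  base: "\<sigma> \<in> \<Sigma> \<Longrightarrow> z \<in> exvars \<sigma> \<Longrightarrow> \<pi> \<in> posns (head \<sigma>) z \<Longrightarrow> affected \<Sigma> (\<sigma>, z) \<pi>"
| step: "\<sigma> \<in> \<Sigma> \<Longrightarrow> x \<in> frontier \<sigma> \<Longrightarrow> \<pi> \<in> posns (head \<sigma>) x \<Longrightarrow>
         (\<forall>\<pi>'\<in>posns (body \<sigma>) x. affected \<Sigma> e \<pi>') \<Longrightarrow> affected \<Sigma> e \<pi>"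

definition aff :: "ontology \<Rightarrow> pos \<Rightarrow> (tgd \<times> nat) set" where
  "aff \<Sigma> \<pi> = {e. affected \<Sigma> e \<pi>}"

definition harmful :: "ontology \<Rightarrow> tgd \<Rightarrow> nat \<Rightarrow> bool" where
  "harmful \<Sigma> \<sigma> x \<longleftrightarrow> x \<in> avars (body \<sigma>) \<and> (\<Inter>\<pi>\<in>posns (body \<sigma>) x. aff \<Sigma> \<pi>) \<noteq> {}"

definition harmless :: "ontology \<Rightarrow> tgd \<Rightarrow> nat \<Rightarrow> bool" where
  "harmless \<Sigma> \<sigma> x \<longleftrightarrow> x \<in> avars (body \<sigma>) \<and> (\<Inter>\<pi>\<in>posns (body \<sigma>) x. aff \<Sigma> \<pi>) = {}"

definition dangerous :: "ontology \<Rightarrow> tgd \<Rightarrow> nat \<Rightarrow> bool" where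
  "dangerous \<Sigma> \<sigma> x \<longleftrightarrow> harmful \<Sigma> \<sigma> x \<and> x \<in> frontier \<sigma>"

inductive problematic :: "ontology \<Rightarrow> tgd \<Rightarrow> atom \<Rightarrow> bool" for \<Sigma> \<sigma> where
  dang: "a \<in> body \<sigma> \<Longrightarrow> x \<in> set (snd a) \<Longrightarrow> dangerous \<Sigma> \<sigma> x \<Longrightarrow> problematic \<Sigma> \<sigma> a"
| share: "a \<in> body \<sigma> \<Longrightarrow> problematic \<Sigma> \<sigma> b \<Longrightarrow> x \<in> set (snd a) \<Longrightarrow> x \<in> set (snd b)
          \<Longrightarrow> harmful \<Sigma> \<sigma> x \<Longrightarrow> problematic \<Sigma> \<sigma> a"

definition p_atoms :: "ontology \<Rightarrow> tgd \<Rightarrow> atom set" where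
  "p_atoms \<Sigma> \<sigma> = {a \<in> body \<sigma>. problematic \<Sigma> \<sigma> a}"

definition s_atoms :: "ontology \<Rightarrow> tgd \<Rightarrow> atom set" where
  "s_atoms \<Sigma> \<sigma> = body \<sigma> - p_atoms \<Sigma> \<sigma>"

definition HF :: "ontology \<Rightarrow> tgd \<Rightarrow> nat set" where
  "HF \<Sigma> \<sigma> = {x \<in> frontier \<sigma>. harmless \<Sigma> \<sigma> x \<and> x \<in> avars (s_atoms \<Sigma> \<sigma>)}"

definition bridge :: "ontology \<Rightarrow> tgd \<Rightarrow> nat set" where
  "bridge \<Sigma> \<sigma> = (avars (p_atoms \<Sigma> \<sigma>) \<inter> avars (s_atoms \<Sigma> \<sigma>)) \<union> HF \<Sigma> \<sigma>"

definition enc_atom :: "atom \<Rightarrow> nat" where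
  "enc_atom a = prod_encode (fst a, list_encode (snd a))"

definition enc_atoms :: "atom list \<Rightarrow> nat" where
  "enc_atoms as = list_encode (map enc_atom as)"

definition enc_tgdl :: "atom list \<times> atom list \<Rightarrow> nat" where
  "enc_tgdl r = prod_encode (enc_atoms (fst r), enc_atoms (snd r))"

text \<open>Fresh predicate Aux_sigma: a canonical choice, larger than every
  predicate symbol of the ontology and injective in sigma.\<close>
definition aux_pred :: "ontology \<Rightarrow> tgd \<Rightarrow> nat" where
  "aux_pred \<Sigma> \<sigma> = Suc (Max (insert 0 (fst ` (\<Union>\<tau>\<in>\<Sigma>. body \<tau> \<union> head \<tau>))))
      + enc_tgdl (sorted_list_of_set (body \<sigma>), sorted_list_of_set (head \<sigma>))"

definition main_tgd :: "ontology \<Rightarrow> tgd \<Rightarrow> tgd" where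
  "main_tgd \<Sigma> \<sigma> = (insert (aux_pred \<Sigma> \<sigma>, sorted_list_of_set (bridge \<Sigma> \<sigma>)) (p_atoms \<Sigma> \<sigma>),
                     head \<sigma>)"

definition main_ont :: "ontology \<Rightarrow> ontology" where
  "main_ont \<Sigma> = main_tgd \<Sigma> ` \<Sigma>"

definition Dyadic :: "ontology set \<Rightarrow> ontology set" where
  "Dyadic C = {\<Sigma>. \<Sigma> \<in> C \<or> main_ont \<Sigma> \<in> C}"

text \<open>Inputs (as concrete syntax): database (list of facts), ontology (list of
  TGDs given by body/head atom lists), CQ (answer variables, body atoms),
  constant tuple.\<close>
type_synonym input = "atom list \<times> (atom list \<times> atom list) list \<times> (nat list \<times> atom list) \<times> nat list"

definition ont_of :: "(atom list \<times> atom list) list \<Rightarrow> ontology" where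
  "ont_of S = (\<lambda>(b, h). (set b, set h)) ` set S"

definition enc_input :: "input \<Rightarrow> nat" where
  "enc_input x = (case x of (D, S, q, c) \<Rightarrow>
     prod_encode (enc_atoms D, prod_encode (list_encode (map enc_tgdl S),
       prod_encode (prod_encode (list_encode (fst q), enc_atoms (snd q)), list_encode c))))"

definition cert_eval :: "ontology set \<Rightarrow> nat set" where
  "cert_eval C = {enc_input (D, S, q, c) | D S q c.
      ont_of S \<in> C \<and> certain (set D) (ont_of S) (fst q, set (snd q)) c}"

end

theory Submission
  imports Defs "HOL-Library.Countable"
begin

text \<open>
  Auxiliary atoms of \<^const>\<open>main_ont\<close> only ever need to hold for constants of the database. Given
  \<open>D\<close> and \<open>\<Sigma>\<close>, let \<open>D\<^sup>*\<close> be the least extension of \<open>D\<close> by facts \<open>Aux\<^sub>\<sigma>(t)\<close> such that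
  \<open>Aux\<^sub>\<sigma>(t)\<close> belongs to it whenever \<open>t\<close> is a certain answer, over \<open>main(\<Sigma>)\<close>, to the query with
  answer variables \<open>bridge(\<sigma>)\<close> and body \<open>s-atoms(\<sigma>)\<close>. It is finite and computable from a decision
  procedure for \<open>main(\<Sigma>)\<close>. Queries have the same certain answers over \<open>(D, \<Sigma>)\<close> and over
  \<open>(D\<^sup>*, main(\<Sigma>))\<close>: a model of \<open>\<Sigma>\<close> expands to one of \<open>main(\<Sigma>)\<close>, and conversely the chase of
  \<open>D\<^sup>*\<close> with \<open>main(\<Sigma>)\<close> is already a model of \<open>\<Sigma>\<close>, since there every null stays inside the positions
  affected by its existential variable, so that harmless variables, and hence the bridge, are
  matched by constants. Therefore an input is accepted for the dyadic class iff it is accepted for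
  \<open>\<C>\<close> or its translation to \<open>(D\<^sup>*, main(\<Sigma>))\<close> is.
\<close>

section \<open>Recursive functions of several arguments\<close>

text \<open>The arity \<open>k\<close> is fixed because \<open>reval\<close> accepts lists of any
  length; the values of \<open>f\<close> on other lengths are left free, which
  \<open>cf_cong\<close> exploits.\<close>

definition cf :: "nat \<Rightarrow> (nat list \<Rightarrow> nat) \<Rightarrow> bool" where
  "cf k f \<longleftrightarrow> (\<exists>r. \<forall>xs. length xs = k \<longrightarrow> reval r xs (f xs))"

lemma cfI: "(\<And>xs. length xs = k \<Longrightarrow> reval r xs (f xs)) \<Longrightarrow> cf k f"
  unfolding cf_def by blast

lemma cf_cong: "cf k f \<Longrightarrow> (\<And>xs. length xs = k \<Longrightarrow> f xs = g xs) \<Longrightarrow> cf k g"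
  unfolding cf_def by metis

lemma cf_nth: "i < k \<Longrightarrow> cf k (\<lambda>xs. xs ! i)"
  by (rule cfI[of _ "Proj i"]) (auto intro: reval.proj)

lemma cf_comp_list:
  assumes "cf (length gs) f" "\<And>g. g \<in> set gs \<Longrightarrow> cf k g"
  shows "cf k (\<lambda>xs. f (map (\<lambda>g. g xs) gs))"
proof -
  obtain r where r: "\<And>ys. length ys = length gs \<Longrightarrow> reval r ys (f ys)"
    using assms(1) unfolding cf_def by auto
  have "\<forall>g\<in>set gs. \<exists>s. \<forall>xs. length xs = k \<longrightarrow> reval s xs (g xs)"
    using assms(2) unfolding cf_def by auto
  then obtain s where s: "\<And>g xs. g \<in> set gs \<Longrightarrow> length xs = k \<Longrightarrow> reval (s g) xs (g xs)"
    by metis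
  show ?thesis
    by (rule cfI[of _ "Cn r (map s gs)"], rule reval.cn[OF _ _ r]) (auto intro: s)
qed

lemma cf_comp1: "cf 1 f \<Longrightarrow> cf k g \<Longrightarrow> cf k (\<lambda>xs. f [g xs])"
  using cf_comp_list[of "[g]" f k] by auto

lemma cf_zero: "cf k (\<lambda>xs. 0)"
  by (rule cfI[of _ Zr]) (rule reval.zr)

lemma cf_Suc: "cf k f \<Longrightarrow> cf k (\<lambda>xs. Suc (f xs))"
proof -
  have "cf 1 (\<lambda>xs. Suc (hd xs))"
    by (rule cfI[of _ Sc]) (auto simp: length_Suc_conv intro: reval.sc)
  then show "cf k f \<Longrightarrow> cf k (\<lambda>xs. Suc (f xs))"
    using cf_comp1 by fastforce
qed

text \<open>\<open>Pr\<close> hands its step function the previous value, then the counter, then the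
  parameters; hence the indices 0 and 1 and \<open>drop 2\<close>.\<close>

lemma cf_rec_nat:
  assumes a: "cf k a" and b: "cf (Suc (Suc k)) (\<lambda>ys. b (ys ! 0) (ys ! 1) (drop 2 ys))" and n: "cf k n"
  shows "cf k (\<lambda>xs. rec_nat (a xs) (\<lambda>i y. b y i xs) (n xs))"
proof -
  obtain ra rb where ra: "\<And>xs. length xs = k \<Longrightarrow> reval ra xs (a xs)"
    and rb: "\<And>ys. length ys = Suc (Suc k) \<Longrightarrow> reval rb ys (b (ys ! 0) (ys ! 1) (drop 2 ys))"
    using a b unfolding cf_def by blast
  have rec: "reval (Pr ra rb) (m # xs) (rec_nat (a xs) (\<lambda>i y. b y i xs) m)"
    if "length xs = k" for m xs
  proof (induction m)
    case 0
    then show ?case using ra[OF that] by (auto intro: reval.pr0)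
  next
    case (Suc m)
    show ?case
      using reval.prS[OF Suc.IH] rb[of "_ # m # xs"] that by simp
  qed
  have "cf (Suc k) (\<lambda>ys. rec_nat (a (tl ys)) (\<lambda>i y. b y i (tl ys)) (hd ys))"
    by (rule cfI[of _ "Pr ra rb"]) (auto simp: length_Suc_conv intro: rec)
  \<comment> \<open>\<open>Pr\<close> recurses on the head of its argument list; composing with
    \<open>n\<close> and the \<open>k\<close> projections installs a computed recursion
    depth.\<close>
  then have "cf k (\<lambda>xs. (\<lambda>ys. rec_nat (a (tl ys)) (\<lambda>i y. b y i (tl ys)) (hd ys))
      (map (\<lambda>g. g xs) (n # map (\<lambda>i xs. xs ! i) [0..<k])))"
    by (intro cf_comp_list) (auto intro: n cf_nth)
  then show ?thesis
    by (rule cf_cong) (auto simp: comp_def map_nth)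
qed

section \<open>Arithmetic and case distinction\<close>

lemma cf_add: "cf k f \<Longrightarrow> cf k g \<Longrightarrow> cf k (\<lambda>xs. f xs + g xs)"
proof -
  assume "cf k f" "cf k g"
  then have "cf k (\<lambda>xs. rec_nat (f xs) (\<lambda>i y. Suc y) (g xs))"
    by (intro cf_rec_nat cf_Suc cf_nth) auto
  moreover have "rec_nat m (\<lambda>i. Suc) n = m + n" for m n :: nat
    by (induction n) auto
  ultimately show ?thesis by simp
qed

lemma cf_pred: "cf k f \<Longrightarrow> cf k (\<lambda>xs. f xs - 1)"
proof -
  assume "cf k f"
  then have "cf k (\<lambda>xs. rec_nat 0 (\<lambda>i y. i) (f xs))"
    by (intro cf_rec_nat cf_zero cf_nth) auto
  moreover have "rec_nat 0 (\<lambda>i y. i) n = n - 1" for n :: nat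
    by (cases n) auto
  ultimately show ?thesis by simp
qed

lemma cf_diff: "cf k f \<Longrightarrow> cf k g \<Longrightarrow> cf k (\<lambda>xs. f xs - g xs)"
proof -
  assume "cf k f" "cf k g"
  then have "cf k (\<lambda>xs. rec_nat (f xs) (\<lambda>i y. y - 1) (g xs))"
    by (intro cf_rec_nat cf_pred cf_nth) auto
  moreover have "rec_nat m (\<lambda>i y. y - 1) n = m - n" for m n :: nat
    by (induction n) auto
  ultimately show ?thesis by simp
qed

lemma cf_if0:
  assumes "cf k c" "cf k f" "cf k g"
  shows "cf k (\<lambda>xs. if c xs = 0 then f xs else g xs)"
proof -
  \<comment> \<open>The nonzero branch is the step of a recursion that ignores the previous value,
    so it must skip the two leading arguments.\<close>
  have g: "cf (Suc (Suc k)) (\<lambda>ys. g (drop 2 ys))"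
  proof -
    have "cf (Suc (Suc k)) (\<lambda>ys. g (map (\<lambda>h. h ys) (map (\<lambda>i ys. ys ! (i + 2)) [0..<k])))"
      using assms(3) by (intro cf_comp_list) (auto intro: cf_nth)
    then show ?thesis
    proof (rule cf_cong)
      fix ys :: "nat list" assume "length ys = Suc (Suc k)"
      then have "map (\<lambda>i. ys ! (i + 2)) [0..<k] = drop 2 ys"
        by (intro nth_equalityI) (auto simp: add.commute)
      then show "g (map (\<lambda>h. h ys) (map (\<lambda>i ys. ys ! (i + 2)) [0..<k])) = g (drop 2 ys)"
        by (simp add: comp_def)
    qed
  qed
  have "cf k (\<lambda>xs. rec_nat (f xs) (\<lambda>i y. g xs) (c xs))"
    by (intro cf_rec_nat assms g)
  then show ?thesis
    by (rule cf_cong) (auto split: nat.split simp: gr0_conv_Suc)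
qed

text \<open>The two truncated differences add up to 0 exactly for equal arguments.\<close>

lemma cf_if_eq:
  assumes "cf k c" "cf k d" "cf k f" "cf k g"
  shows "cf k (\<lambda>xs. if c xs = d xs then f xs else g xs)"
  using cf_if0[OF cf_add[OF cf_diff[OF assms(1,2)] cf_diff[OF assms(2,1)]] assms(3,4)]
  by (rule cf_cong) auto

section \<open>Cantor pairing and its inverse\<close>

lemma cf_triangle: "cf k f \<Longrightarrow> cf k (\<lambda>xs. triangle (f xs))"
proof -
  assume "cf k f"
  then have "cf k (\<lambda>xs. rec_nat 0 (\<lambda>i y. y + Suc i) (f xs))"
    by (intro cf_rec_nat cf_zero cf_add cf_Suc cf_nth) auto
  moreover have "rec_nat 0 (\<lambda>i y. y + Suc i) n = triangle n" for n
    by (induction n) auto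
  ultimately show ?thesis by simp
qed

lemma cf_prod_encode: "cf k f \<Longrightarrow> cf k g \<Longrightarrow> cf k (\<lambda>xs. prod_encode (f xs, g xs))"
  unfolding prod_encode_def prod.case by (intro cf_add cf_triangle)

text \<open>The index of the diagonal of the Cantor pairing on which a number lies.\<close>
definition diag :: "nat \<Rightarrow> nat" where
  "diag = rec_nat 0 (\<lambda>i y. if Suc i = triangle (Suc y) then Suc y else y)"

lemma diag_bounds: "triangle (diag n) \<le> n \<and> n < triangle (Suc (diag n))"
  by (induction n) (auto simp: diag_def)

text \<open>Reduces unpairing to subtraction, \<open>triangle\<close> and \<open>diag\<close>, all
  of which are primitive recursive.\<close>

lemma prod_decode_diag:
  "prod_decode n = (n - triangle (diag n), diag n - (n - triangle (diag n)))"
proof -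
  have "n = prod_encode (n - triangle (diag n), diag n - (n - triangle (diag n)))"
    using diag_bounds[of n] by (auto simp: prod_encode_def)
  then show ?thesis by (metis prod_encode_inverse)
qed

lemma cf_diag: "cf k f \<Longrightarrow> cf k (\<lambda>xs. diag (f xs))"
  unfolding diag_def
  by (intro cf_rec_nat cf_zero cf_if_eq cf_Suc cf_triangle cf_nth) auto

lemma cf_fst_decode: "cf k f \<Longrightarrow> cf k (\<lambda>xs. fst (prod_decode (f xs)))"
  unfolding prod_decode_diag fst_conv by (intro cf_diff cf_triangle cf_diag)

lemma cf_snd_decode: "cf k f \<Longrightarrow> cf k (\<lambda>xs. snd (prod_decode (f xs)))"
  unfolding prod_decode_diag snd_conv by (intro cf_diff cf_triangle cf_diag)

lemma cf_const: "cf k (\<lambda>xs. c)"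
  by (induction c) (auto intro: cf_zero cf_Suc)

text \<open>\<open>Mn\<close> also requires values at all smaller arguments, which the total
  \<open>f\<close> has; \<open>ex\<close> makes the search stop.\<close>

lemma cf_Least:
  assumes "cf (Suc k) (\<lambda>ys. f (hd ys) (tl ys))" and ex: "\<And>xs. length xs = k \<Longrightarrow> \<exists>n. f n xs = 0"
  shows "cf k (\<lambda>xs. LEAST n. f n xs = 0)"
proof -
  obtain r where *: "\<And>ys. length ys = Suc k \<Longrightarrow> reval r ys (f (hd ys) (tl ys))"
    using assms(1) unfolding cf_def by blast
  have r: "reval r (n # xs) (f n xs)" if "length xs = k" for n xs
    using *[of "n # xs"] that by simp
  show ?thesis
  proof (rule cfI[of _ "Mn r"], rule reval.mn)
    fix xs :: "nat list" assume l: "length xs = k"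
    show "reval r ((LEAST n. f n xs = 0) # xs) 0"
      using r[OF l, of "LEAST n. f n xs = 0"] LeastI_ex[OF ex[OF l]] by simp
    show "\<forall>m<LEAST n. f n xs = 0. \<exists>k>0. reval r (m # xs) k"
      using r[OF l] not_less_Least by (metis (mono_tags, lifting) gr0I)
  qed
qed

section \<open>Computability over encoded data\<close>

text \<open>A bijection rather than an injection makes every number a valid code, so
  \<open>code_decode\<close> holds without side condition. The instances use the pairing and list
  codes of \<open>enc_input\<close>, which thereby coincides with \<open>code\<close>.\<close>

class coded =
  fixes code :: "'a \<Rightarrow> nat"
  assumes bij_code: "bij code"

definition decode :: "nat \<Rightarrow> 'a::coded" where
  "decode = inv code"

lemma decode_code [simp]: "decode (code x) = x"
  unfolding decode_def by (simp add: bij_code bij_is_inj)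

lemma code_decode [simp]: "code (decode n :: 'a::coded) = n"
  unfolding decode_def by (simp add: bij_code bij_is_surj surj_f_inv_f)

lemma code_eq_iff [simp]: "code x = code y \<longleftrightarrow> x = y"
  by (metis decode_code)

instantiation nat :: coded
begin
definition code_nat :: "nat \<Rightarrow> nat" where [simp]: "code_nat n = n"
instance by standard (auto simp: bij_def inj_def surj_def)
end

instantiation prod :: (coded, coded) coded
begin
definition code_prod :: "'a \<times> 'b \<Rightarrow> nat" where
  "code_prod p = prod_encode (code (fst p), code (snd p))"
instance
proof
  have "inj (code :: 'a \<times> 'b \<Rightarrow> nat)"
    by (auto simp: inj_def code_prod_def prod_eq_iff)
  moreover have "n = code (decode (fst (prod_decode n)) :: 'a, decode (snd (prod_decode n)) :: 'b)" for n
    by (simp add: code_prod_def)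
  ultimately show "bij (code :: 'a \<times> 'b \<Rightarrow> nat)"
    unfolding bij_def surj_def by blast
qed
end

instantiation list :: (coded) coded
begin
definition code_list :: "'a list \<Rightarrow> nat" where
  "code_list xs = list_encode (map code xs)"
instance
proof
  have "inj (code :: 'a list \<Rightarrow> nat)"
    by (auto simp: inj_def code_list_def list_encode_eq inj_map_eq_map)
  moreover have "n = code (map decode (list_decode n) :: 'a list)" for n
    by (simp add: code_list_def comp_def)
  ultimately show "bij (code :: 'a list \<Rightarrow> nat)"
    unfolding bij_def surj_def by blast
qed
end

lemma code_Nil [simp]: "code [] = 0"
  by (simp add: code_list_def)

lemma code_Cons: "code (x # xs) = Suc (prod_encode (code x, code xs))"
  by (simp add: code_list_def)

definition cmp :: "('a::coded \<Rightarrow> 'b::coded) \<Rightarrow> bool" where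
  "cmp f \<longleftrightarrow> cf 1 (\<lambda>xs. code (f (decode (xs ! 0))))"

definition dec :: "('a::coded \<Rightarrow> bool) \<Rightarrow> bool" where
  "dec P \<longleftrightarrow> cmp (\<lambda>x. if P x then 1 else 0 :: nat)"

lemma cmp_app:
  assumes "cmp f" "cf k (\<lambda>xs. code (g xs))"
  shows "cf k (\<lambda>xs. code (f (g xs)))"
  using cf_comp1[OF assms(1)[unfolded cmp_def] assms(2)] by simp

lemma decode_nat [simp]: "decode n = (n :: nat)"
  by (metis code_decode code_nat_def)

lemma cmp_decode: "cmp (decode :: nat \<Rightarrow> 'a::coded)"
  by (simp add: cmp_def cf_nth)

lemma cmp_code: "cmp (\<lambda>x. code (f x)) \<longleftrightarrow> cmp f"
  by (simp add: cmp_def)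

lemma decidable_iff_dec: "decidable L \<longleftrightarrow> dec (\<lambda>n. n \<in> L)"
proof -
  have "(\<forall>n. P [n]) \<longleftrightarrow> (\<forall>xs. length xs = 1 \<longrightarrow> P xs)" for P :: "nat list \<Rightarrow> bool"
    by (auto simp: length_Suc_conv)
  from this[of "\<lambda>xs. reval r xs (if xs ! 0 \<in> L then 1 else 0)" for r]
  show ?thesis
    by (simp add: decidable_def dec_def cmp_def cf_def)
qed

lemma cmp_comp: "cmp f \<Longrightarrow> cmp g \<Longrightarrow> cmp (\<lambda>x. f (g x))"
  using cmp_app[of f 1 "\<lambda>xs. g (decode (xs ! 0))"] by (simp add: cmp_def)

lemma dec_comp: "dec P \<Longrightarrow> cmp g \<Longrightarrow> dec (\<lambda>x. P (g x))"
  unfolding dec_def by (rule cmp_comp)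

text \<open>The rules follow the syntax of a term with one hidden parameter, so
  \<open>intro cmp_intros\<close> shows computability by structure.\<close>

named_theorems cmp_intros

lemma cmp_id [cmp_intros]: "cmp (\<lambda>x. x)"
  unfolding cmp_def by (simp add: cf_nth)

lemma cmp_const [cmp_intros]: "cmp (\<lambda>x. c)"
  unfolding cmp_def by (rule cf_const)

lemma cmp_Pair [cmp_intros]: "cmp f \<Longrightarrow> cmp g \<Longrightarrow> cmp (\<lambda>x. (f x, g x))"
  unfolding cmp_def code_prod_def fst_conv snd_conv by (rule cf_prod_encode)

lemma cmp_fst [cmp_intros]: "cmp f \<Longrightarrow> cmp (\<lambda>x. fst (f x))"
proof -
  assume "cmp f"
  from cf_fst_decode[OF this[unfolded cmp_def]] show ?thesis
    unfolding cmp_def by (simp add: code_prod_def)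
qed

lemma cmp_snd [cmp_intros]: "cmp f \<Longrightarrow> cmp (\<lambda>x. snd (f x))"
proof -
  assume "cmp f"
  from cf_snd_decode[OF this[unfolded cmp_def]] show ?thesis
    unfolding cmp_def by (simp add: code_prod_def)
qed

text \<open>A curried function is shown computable once, on pairs, and then applied to arbitrary
  computable arguments.\<close>

lemma cmp2:
  assumes "cmp (\<lambda>p. h (fst p) (snd p))" "cmp f" "cmp g"
  shows "cmp (\<lambda>x. h (f x) (g x))"
  using cmp_comp[OF assms(1) cmp_Pair[OF assms(2,3)]] by simp

lemma dec2:
  assumes "dec (\<lambda>p. P (fst p) (snd p))" "cmp f" "cmp g"
  shows "dec (\<lambda>x. P (f x) (g x))"
  using dec_comp[OF assms(1) cmp_Pair[OF assms(2,3)]] by simp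

lemma cmp3:
  assumes "cmp (\<lambda>p. h (fst p) (fst (snd p)) (snd (snd p)))" "cmp f" "cmp g" "cmp k"
  shows "cmp (\<lambda>x. h (f x) (g x) (k x))"
  using cmp_comp[OF assms(1) cmp_Pair[OF assms(2) cmp_Pair[OF assms(3,4)]]] by simp

lemma dec3:
  assumes "dec (\<lambda>p. P (fst p) (fst (snd p)) (snd (snd p)))" "cmp f" "cmp g" "cmp k"
  shows "dec (\<lambda>x. P (f x) (g x) (k x))"
  using dec_comp[OF assms(1) cmp_Pair[OF assms(2) cmp_Pair[OF assms(3,4)]]] by simp

lemma cmp_Suc [cmp_intros]: "cmp f \<Longrightarrow> cmp (\<lambda>x. Suc (f x))"
  unfolding cmp_def code_nat_def by (rule cf_Suc)

lemma cmp_plus [cmp_intros]: "cmp f \<Longrightarrow> cmp g \<Longrightarrow> cmp (\<lambda>x. f x + g x :: nat)"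
  unfolding cmp_def code_nat_def by (rule cf_add)

lemma cmp_minus [cmp_intros]: "cmp f \<Longrightarrow> cmp g \<Longrightarrow> cmp (\<lambda>x. f x - g x :: nat)"
  unfolding cmp_def code_nat_def by (rule cf_diff)

lemma cmp_if [cmp_intros]:
  assumes "dec P" "cmp f" "cmp g"
  shows "cmp (\<lambda>x. if P x then f x else g x)"
proof -
  have "cf 1 (\<lambda>xs. if code (if P (decode (xs ! 0)) then 1 else 0 :: nat) = 0
      then code (g (decode (xs ! 0))) else code (f (decode (xs ! 0))))"
    using assms unfolding dec_def cmp_def by (intro cf_if0)
  then show ?thesis
    unfolding cmp_def by (rule cf_cong) auto
qed

lemma dec_eq [cmp_intros]: "cmp f \<Longrightarrow> cmp g \<Longrightarrow> dec (\<lambda>x. f x = g x)"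
proof -
  assume "cmp f" "cmp g"
  then have "cf 1 (\<lambda>xs. if code (f (decode (xs ! 0))) = code (g (decode (xs ! 0))) then 1 else 0)"
    unfolding cmp_def by (intro cf_if_eq cf_const)
  then show ?thesis
    unfolding dec_def cmp_def by (rule cf_cong) auto
qed

lemma dec_iff_cmp: "cmp f \<Longrightarrow> (\<And>x. P x \<longleftrightarrow> f x = (0 :: nat)) \<Longrightarrow> dec P"
proof -
  assume "cmp f" "\<And>x. P x \<longleftrightarrow> f x = (0 :: nat)"
  moreover from this(2) have "P = (\<lambda>x. f x = 0)" by auto
  ultimately show ?thesis using dec_eq[OF _ cmp_const[of 0], of f] by simp
qed

lemma dec_not [cmp_intros]: "dec P \<Longrightarrow> dec (\<lambda>x. \<not> P x)"
  by (rule dec_iff_cmp[of "\<lambda>x. if P x then 1 else 0"]) (auto simp: dec_def)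

lemma dec_conj [cmp_intros]: "dec P \<Longrightarrow> dec Q \<Longrightarrow> dec (\<lambda>x. P x \<and> Q x)"
  by (rule dec_iff_cmp[of "\<lambda>x. if P x then if Q x then 0 else 1 else 1"])
     (auto intro!: cmp_if cmp_const)

lemma dec_disj [cmp_intros]: "dec P \<Longrightarrow> dec Q \<Longrightarrow> dec (\<lambda>x. P x \<or> Q x)"
  by (rule dec_iff_cmp[of "\<lambda>x. if P x then 0 else if Q x then 0 else 1"])
     (auto intro!: cmp_if cmp_const)

lemma dec_imp [cmp_intros]: "dec P \<Longrightarrow> dec Q \<Longrightarrow> dec (\<lambda>x. P x \<longrightarrow> Q x)"
  by (rule dec_iff_cmp[of "\<lambda>x. if P x then if Q x then 0 else 1 else 0"])
     (auto intro!: cmp_if cmp_const)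

lemma dec_le [cmp_intros]: "cmp f \<Longrightarrow> cmp g \<Longrightarrow> dec (\<lambda>x. f x \<le> (g x :: nat))"
  by (rule dec_iff_cmp[of "\<lambda>x. f x - g x"]) (auto intro: cmp_minus)

lemma dec_less [cmp_intros]: "cmp f \<Longrightarrow> cmp g \<Longrightarrow> dec (\<lambda>x. f x < (g x :: nat))"
  by (rule dec_iff_cmp[of "\<lambda>x. Suc (f x) - g x"]) (auto intro: cmp_minus cmp_Suc)

lemma cmp_funpow [cmp_intros]:
  fixes step :: "'a::coded \<Rightarrow> 'b::coded \<Rightarrow> 'b"
  assumes step: "cmp (\<lambda>p. step (fst p) (snd p))" and "cmp n" "cmp s"
  shows "cmp (\<lambda>x. (step x ^^ n x) (s x))"
proof -
  \<comment> \<open>\<open>cf_rec_nat\<close> puts the previous value at index 0 and, after the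
    counter, the parameter at index 2.\<close>
  have "cf 3 (\<lambda>ys. code (step (decode (ys ! 2)) (decode (ys ! 0))))"
  proof -
    have "cf 3 (\<lambda>ys. code (decode (ys ! 2) :: 'a, decode (ys ! 0) :: 'b))"
      by (auto simp: code_prod_def intro!: cf_prod_encode cf_nth)
    from cmp_app[OF step this] show ?thesis by simp
  qed
  then have "cf (Suc (Suc 1)) (\<lambda>ys. code (step (decode (drop 2 ys ! 0)) (decode (ys ! 0))))"
    by (auto simp: numeral_3_eq_3 numeral_2_eq_2 intro: cf_cong)
  then have "cf 1 (\<lambda>xs. rec_nat (code (s (decode (xs ! 0))))
      (\<lambda>i y. code (step (decode (xs ! 0)) (decode y))) (code (n (decode (xs ! 0)))))"
    using assms(2,3) unfolding cmp_def by (intro cf_rec_nat)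
  moreover have "rec_nat (code a) (\<lambda>i y. code (g (decode y))) m = code ((g ^^ m) a)"
    for a :: 'b and g :: "'b \<Rightarrow> 'b" and m
    by (induction m) auto
  ultimately show ?thesis by (simp add: cmp_def)
qed

text \<open>Every \<open>y\<close> has a code, so a search through the numbers reaches a
  witness.\<close>

lemma cmp_search:
  fixes P :: "'a::coded \<Rightarrow> 'b::coded \<Rightarrow> bool"
  assumes "dec (\<lambda>p. P (fst p) (snd p))" "\<And>x. \<exists>y. P x y"
  shows "\<exists>f. cmp f \<and> (\<forall>x. P x (f x))"
proof -
  \<comment> \<open>Minimisation looks for a zero, so the truth value is inverted.\<close>
  define t where "t n xs = 1 - code (if P (decode (xs ! 0)) (decode n) then 1 else 0 :: nat)" for n xs
  define f where "f x = (decode (LEAST n. t n [code x] = 0) :: 'b)" for x :: 'a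
  have ex: "\<exists>n. t n [code x] = 0" for x :: 'a
    using assms(2)[of x] by (auto simp: t_def) (metis decode_code)
  have "cf 2 (\<lambda>ys. code (decode (tl ys ! 0) :: 'a, decode (hd ys) :: 'b))"
    unfolding code_prod_def fst_conv snd_conv code_decode
    by (rule cf_cong[OF cf_prod_encode[OF cf_nth[of 1] cf_nth[of 0]]]) (auto simp: length_Suc_conv numeral_2_eq_2)
  from cmp_app[OF assms(1)[unfolded dec_def] this]
  have "cf (Suc 1) (\<lambda>ys. t (hd ys) (tl ys))"
    unfolding t_def by (intro cf_diff cf_const) (simp add: numeral_2_eq_2)
  moreover have "\<exists>n. t n xs = 0" if "length xs = 1" for xs
    using ex[of "decode (xs ! 0)"] by (auto simp: t_def)
  ultimately have "cf 1 (\<lambda>xs. LEAST n. t n xs = 0)"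
    by (rule cf_Least)
  then have "cmp f"
    unfolding cmp_def by (rule cf_cong) (auto simp: f_def length_Suc_conv)
  moreover have "P x (f x)" for x
    using LeastI_ex[OF ex[of x]] by (auto simp: f_def t_def split: if_splits)
  ultimately show ?thesis by blast
qed

text \<open>Lets a function be computed from a decidable specification; sorting and maxima are
  treated this way.\<close>

lemma cmp_graph:
  assumes "dec (\<lambda>p. P (fst p) (snd p))" "\<And>x y. P x y \<longleftrightarrow> y = f x"
  shows "cmp f"
proof -
  obtain g where "cmp g" "\<forall>x. P x (g x)"
    using cmp_search[OF assms(1)] assms(2) by blast
  moreover from this have "g = f" using assms(2) by blast
  ultimately show ?thesis by simp
qed

subsection \<open>Lists\<close>

lemma cmp_Cons [cmp_intros]: "cmp f \<Longrightarrow> cmp g \<Longrightarrow> cmp (\<lambda>x. f x # g x)"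
  unfolding cmp_def code_Cons by (intro cf_Suc cf_prod_encode)

lemma cmp_hd [cmp_intros]: "cmp f \<Longrightarrow> cmp (\<lambda>x. hd (f x))"
proof -
  assume "cmp f"
  \<comment> \<open>\<open>hd []\<close> is unspecified but one fixed value, so it enters as a
    constant.\<close>
  then have "cf 1 (\<lambda>xs. if code (f (decode (xs ! 0))) = 0 then code (hd [] :: 'b)
      else fst (prod_decode (code (f (decode (xs ! 0))) - 1)))"
    unfolding cmp_def by (intro cf_if0 cf_const cf_fst_decode cf_pred)
  moreover have "(if code ys = 0 then code (hd [] :: 'b) else fst (prod_decode (code ys - 1))) = code (hd ys)"
    for ys :: "'b list"
    by (cases ys) (auto simp: code_Cons)
  ultimately show ?thesis by (simp add: cmp_def)
qed

lemma cmp_tl [cmp_intros]: "cmp f \<Longrightarrow> cmp (\<lambda>x. tl (f x))"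
proof -
  assume "cmp f"
  then have "cf 1 (\<lambda>xs. if code (f (decode (xs ! 0))) = 0 then 0
      else snd (prod_decode (code (f (decode (xs ! 0))) - 1)))"
    unfolding cmp_def by (intro cf_if0 cf_const cf_snd_decode cf_pred)
  moreover have "(if code ys = 0 then 0 else snd (prod_decode (code ys - 1))) = code (tl ys)"
    for ys :: "'b list"
    by (cases ys) (auto simp: code_Cons)
  ultimately show ?thesis by (simp add: cmp_def)
qed

lemma length_le_code: "length xs \<le> code xs"
proof (induction xs)
  case (Cons x xs)
  then show ?case using le_prod_encode_2[of "code xs" "code x"] by (simp add: code_Cons)
qed simp

text \<open>The code of a list bounds its length, so it serves as the number of iterations.\<close>
lemma cmp_fold [cmp_intros]:
  fixes g :: "'a::coded \<Rightarrow> 'b::coded \<Rightarrow> 'c::coded \<Rightarrow> 'c"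
  assumes "cmp (\<lambda>p. g (fst p) (fst (snd p)) (snd (snd p)))" "cmp l" "cmp s"
  shows "cmp (\<lambda>x. fold (g x) (l x) (s x))"
proof -
  \<comment> \<open>The state is the remaining list with the accumulator; it is stationary once the
    list is empty, so surplus iterations do no harm.\<close>
  define step where "step x ps = (if fst ps = [] then ps else (tl (fst ps), g x (hd (fst ps)) (snd ps)))"
    for x and ps :: "'b list \<times> 'c"
  have "cmp (\<lambda>p. step (fst p) (snd p))"
    unfolding step_def by (intro cmp_intros cmp3[OF assms(1)])
  then have "cmp (\<lambda>x. snd ((step x ^^ code (l x)) (l x, s x)))"
    using assms(2,3) by (intro cmp_intros) (simp_all add: cmp_code)
  moreover have step_simps: "step x ([], a) = ([], a)" "step x (y # ys, a) = (ys, g x y a)" for x y ys a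
    by (simp_all add: step_def)
  have "length ys \<le> n \<Longrightarrow> (step x ^^ n) (ys, a) = ([], fold (g x) ys a)" for x ys n a
  proof (induction n arbitrary: ys a)
    case (Suc n)
    have "(step x ^^ Suc n) (ys, a) = (step x ^^ n) (step x (ys, a))"
      by (simp add: funpow_swap1)
    then show ?case
      using Suc by (cases ys) (simp_all add: step_simps)
  qed simp
  ultimately show ?thesis by (simp add: length_le_code)
qed

lemma cmp_rev [cmp_intros]: "cmp l \<Longrightarrow> cmp (\<lambda>x. rev (l x))"
proof -
  assume "cmp l"
  then have "cmp (\<lambda>x. fold (\<lambda>y ys. y # ys) (l x) [])"
    by (intro cmp_intros)
  then show ?thesis by (simp add: rev_conv_fold)
qed

lemma cmp_foldr [cmp_intros]:
  assumes "cmp (\<lambda>p. g (fst p) (fst (snd p)) (snd (snd p)))" "cmp l" "cmp s"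
  shows "cmp (\<lambda>x. foldr (g x) (l x) (s x))"
  unfolding foldr_conv_fold using assms by (intro cmp_intros)

lemma cmp_append [cmp_intros]: "cmp l \<Longrightarrow> cmp m \<Longrightarrow> cmp (\<lambda>x. l x @ m x)"
proof -
  assume "cmp l" "cmp m"
  then have "cmp (\<lambda>x. foldr (\<lambda>y ys. y # ys) (l x) (m x))"
    by (intro cmp_intros)
  moreover have "foldr (#) xs ys = xs @ ys" for xs ys :: "'b list"
    by (induction xs) auto
  ultimately show ?thesis by simp
qed

lemma cmp_map [cmp_intros]:
  assumes "cmp (\<lambda>p. f (fst p) (snd p))" "cmp l"
  shows "cmp (\<lambda>x. map (f x) (l x))"
proof -
  have "cmp (\<lambda>x. foldr (\<lambda>y ys. f x y # ys) (l x) [])"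
    by (intro cmp_intros cmp2[OF assms(1)] assms(2))
  moreover have "foldr (\<lambda>y ys. f x y # ys) ys [] = map (f x) ys" for x ys
    by (induction ys) auto
  ultimately show ?thesis by simp
qed

lemma cmp_concat [cmp_intros]: "cmp l \<Longrightarrow> cmp (\<lambda>x. concat (l x))"
proof -
  assume "cmp l"
  then have "cmp (\<lambda>x. foldr (\<lambda>y ys. y @ ys) (l x) [])"
    by (intro cmp_intros)
  then show ?thesis by (simp add: concat_conv_foldr)
qed

lemma cmp_filter [cmp_intros]:
  assumes "dec (\<lambda>p. P (fst p) (snd p))" "cmp l"
  shows "cmp (\<lambda>x. filter (P x) (l x))"
proof -
  have "cmp (\<lambda>x. concat (map (\<lambda>y. if P x y then [y] else []) (l x)))"
    by (intro cmp_intros assms)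
  moreover have "concat (map (\<lambda>y. if P x y then [y] else []) ys) = filter (P x) ys" for x ys
    by (induction ys) auto
  ultimately show ?thesis by simp
qed

lemma dec_ball [cmp_intros]:
  assumes "cmp l" "dec (\<lambda>p. P (fst p) (snd p))"
  shows "dec (\<lambda>x. \<forall>y\<in>set (l x). P x y)"
proof -
  have "dec (\<lambda>x. filter (\<lambda>y. \<not> P x y) (l x) = [])"
    by (intro cmp_intros assms)
  then show ?thesis by (simp add: filter_empty_conv)
qed

lemma dec_bex [cmp_intros]:
  assumes "cmp l" "dec (\<lambda>p. P (fst p) (snd p))"
  shows "dec (\<lambda>x. \<exists>y\<in>set (l x). P x y)"
proof -
  have "dec (\<lambda>x. \<not> (\<forall>y\<in>set (l x). \<not> P x y))"
    by (intro cmp_intros assms)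
  then show ?thesis by simp
qed

lemma dec_member [cmp_intros]: "cmp f \<Longrightarrow> cmp l \<Longrightarrow> dec (\<lambda>x. f x \<in> set (l x))"
proof -
  assume f: "cmp f" and l: "cmp l"
  have "dec (\<lambda>x. \<exists>y\<in>set (l x). y = f x)"
    by (intro cmp_intros cmp_comp[OF f] l)
  then show ?thesis by simp
qed

lemma dec_subset [cmp_intros]: "cmp l \<Longrightarrow> cmp m \<Longrightarrow> dec (\<lambda>x. set (l x) \<subseteq> set (m x))"
proof -
  assume l: "cmp l" and m: "cmp m"
  show ?thesis unfolding subset_eq by (intro cmp_intros cmp_comp[OF m] l)
qed

lemma cmp_length [cmp_intros]: "cmp l \<Longrightarrow> cmp (\<lambda>x. length (l x))"
proof -
  assume "cmp l"
  then have "cmp (\<lambda>x. foldr (\<lambda>y n. Suc n) (l x) 0)"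
    by (intro cmp_intros)
  moreover have "foldr (\<lambda>y n. Suc n) ys 0 = length ys" for ys :: "'b list"
    by (induction ys) auto
  ultimately show ?thesis by simp
qed

lemma cmp_drop [cmp_intros]: "cmp n \<Longrightarrow> cmp l \<Longrightarrow> cmp (\<lambda>x. drop (n x) (l x))"
proof -
  assume "cmp n" "cmp l"
  then have "cmp (\<lambda>x. (tl ^^ n x) (l x))"
    by (intro cmp_intros)
  moreover have "(tl ^^ i) ys = drop i ys" for i and ys :: "'b list"
    by (induction i) (simp_all, metis drop_Suc tl_drop)
  ultimately show ?thesis by simp
qed

lemma cmp_take [cmp_intros]: "cmp n \<Longrightarrow> cmp l \<Longrightarrow> cmp (\<lambda>x. take (n x) (l x))"
proof -
  assume "cmp n" "cmp l"
  then have "cmp (\<lambda>x. rev (drop (length (l x) - n x) (rev (l x))))"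
    by (intro cmp_intros)
  moreover have "rev (drop (length ys - i) (rev ys)) = take i ys" for i and ys :: "'b list"
    by (cases "i \<le> length ys") (simp_all add: drop_rev)
  ultimately show ?thesis by simp
qed

lemma cmp_upt [cmp_intros]: "cmp n \<Longrightarrow> cmp (\<lambda>x. [0..<n x])"
proof -
  assume "cmp n"
  then have "cmp (\<lambda>x. ((\<lambda>l. l @ [length l]) ^^ n x) [])"
    by (intro cmp_intros)
  moreover have "((\<lambda>l. l @ [length l]) ^^ i) [] = [0..<i]" for i
    by (induction i) auto
  ultimately show ?thesis by simp
qed

lemma cmp_sum_list [cmp_intros]: "cmp l \<Longrightarrow> cmp (\<lambda>x. sum_list (l x) :: nat)"
proof -
  assume "cmp l"
  then have "cmp (\<lambda>x. foldr (\<lambda>y n. y + n) (l x) 0)"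
    by (intro cmp_intros)
  then show ?thesis by (simp add: sum_list.eq_foldr)
qed

lemma cmp_n_lists [cmp_intros]: "cmp n \<Longrightarrow> cmp l \<Longrightarrow> cmp (\<lambda>x. List.n_lists (n x) (l x))"
proof -
  assume n: "cmp n" and l: "cmp l"
  have "cmp (\<lambda>x. ((\<lambda>L. concat (map (\<lambda>ys. map (\<lambda>y. y # ys) (l x)) L)) ^^ n x) [[]])"
    by (intro cmp_intros cmp_comp[OF l] n)
  moreover have "((\<lambda>L. concat (map (\<lambda>ys. map (\<lambda>y. y # ys) m) L)) ^^ i) [[]] = List.n_lists i m"
    for i and m :: "'b list"
    by (induction i) auto
  ultimately show ?thesis by simp
qed

subsection \<open>Sorting\<close>

lemma ball_upt_Suc: "(\<forall>i\<in>set [0..<Suc n]. Q i) \<longleftrightarrow> Q 0 \<and> (\<forall>i\<in>set [0..<n]. Q (Suc i))"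
  by (simp only: set_upt atLeast0LessThan lessThan_Suc_eq_insert_0 ball_simps)

text \<open>The graph is decidable because a strictly sorted list is determined by its set of
  entries.\<close>

lemma cmp_sorted_list_of_set:
  assumes less: "dec (\<lambda>p. fst p < (snd p :: 'b :: {coded, linorder}))" and l: "cmp l"
  shows "cmp (\<lambda>x. sorted_list_of_set (set (l x) :: 'b set))"
proof (rule cmp_comp[OF _ l], rule cmp_graph)
  show "dec (\<lambda>p. (\<forall>i\<in>set [0..<length (snd p)]. \<forall>y\<in>set (drop (Suc i) (snd p)). hd (drop i (snd p)) < y) \<and>
      set (snd p) \<subseteq> set (fst p) \<and> set (fst p) \<subseteq> (set (snd p) :: 'b set))"
    by (intro cmp_intros dec2[of "(<)", OF less])
  fix xs ys :: "'b list"
  have "(\<forall>i\<in>set [0..<length ys]. \<forall>y\<in>set (drop (Suc i) ys). hd (drop i ys) < y) \<longleftrightarrow> sorted_wrt (<) ys"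
  proof (induction ys)
    case (Cons y ys)
    then show ?case unfolding list.size(4) ball_upt_Suc add_Suc_right add_0_right by simp
  qed simp
  then show "((\<forall>i\<in>set [0..<length ys]. \<forall>y\<in>set (drop (Suc i) ys). hd (drop i ys) < y) \<and>
      set ys \<subseteq> set xs \<and> set xs \<subseteq> set ys) \<longleftrightarrow> ys = sorted_list_of_set (set xs)"
    using strict_sorted_equal[of "sorted_list_of_set (set xs)" ys] by auto
qed

lemma dec_less_nat_list: "cmp f \<Longrightarrow> cmp g \<Longrightarrow> dec (\<lambda>x. f x < (g x :: nat list))"
proof (rule dec2[of "(<)"])
  \<comment> \<open>Either a proper prefix or a first difference; \<open>hd (drop i xs)\<close>
    expresses \<open>xs ! i\<close> in the vocabulary of \<open>cmp_intros\<close>.\<close>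
  have less: "xs < ys \<longleftrightarrow> length xs < length ys \<and> take (length xs) ys = xs \<or>
      (\<exists>i\<in>set [0..<length xs]. i < length ys \<and> take i xs = take i ys \<and> hd (drop i xs) < hd (drop i ys))"
    for xs ys :: "nat list"
    unfolding list_less_def lexord_take_index_conv by (auto simp: hd_drop_conv_nth)
  show "dec (\<lambda>p. fst p < (snd p :: nat list))"
    unfolding less by (intro cmp_intros)
qed

lemma dec_less_atom: "dec (\<lambda>p. fst p < (snd p :: atom))"
proof -
  have "dec (\<lambda>p. fst (fst p) < fst (snd p) \<or> fst (fst p) = fst (snd p) \<and> snd (fst p) < snd (snd p :: atom))"
    by (intro cmp_intros dec_less_nat_list)
  then show ?thesis by (simp add: less_prod_def')
qed

lemmas cmp_sort [cmp_intros] =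
  cmp_sorted_list_of_set[OF dec_less[OF cmp_fst[OF cmp_id] cmp_snd[OF cmp_id]]]
  cmp_sorted_list_of_set[OF dec_less_atom]

subsection \<open>Least fixed points\<close>

text \<open>The search looks for a closed list in which every entry is justified by the entries after it.\<close>
lemma cmp_least_fixpoint:
  fixes J :: "'a::coded \<Rightarrow> 'b::coded \<Rightarrow> 'b set \<Rightarrow> bool"
  assumes J: "dec (\<lambda>p. J (fst p) (fst (snd p)) (set (snd (snd p))))" and U: "cmp U"
    and mono: "\<And>x y A B. J x y A \<Longrightarrow> A \<subseteq> B \<Longrightarrow> J x y B"
  obtains f where "cmp f" "\<And>x. set (f x) \<subseteq> set (U x)"
    "\<And>x y. y \<in> set (U x) \<Longrightarrow> J x y (set (f x)) \<Longrightarrow> y \<in> set (f x)"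
    "\<And>x T. (\<And>y. y \<in> set (U x) \<Longrightarrow> J x y T \<Longrightarrow> y \<in> T) \<Longrightarrow> set (f x) \<subseteq> T"
proof -
  define ok where "ok x l \<longleftrightarrow> (\<forall>i\<in>set [0..<length l]. hd (drop i l) \<in> set (U x) \<and>
      J x (hd (drop i l)) (set (drop (Suc i) l)))" for x l
  have ok_Nil: "ok x []" for x by (simp add: ok_def)
  have ok_Cons: "ok x (y # l) \<longleftrightarrow> y \<in> set (U x) \<and> J x y (set l) \<and> ok x l" for x y l
    unfolding ok_def list.size(4) ball_upt_Suc add_Suc_right add_0_right by simp
  have ok_U: "ok x l \<Longrightarrow> set l \<subseteq> set (U x)" for x l
    by (induction l) (auto simp: ok_Cons)
  have least: "ok x l \<Longrightarrow> (\<And>y. y \<in> set (U x) \<Longrightarrow> J x y T \<Longrightarrow> y \<in> T) \<Longrightarrow> set l \<subseteq> T" for x l T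
    by (induction l) (auto simp: ok_Cons intro: mono)
  define closed where "closed x l \<longleftrightarrow> (\<forall>y\<in>set (U x). J x y (set l) \<longrightarrow> y \<in> set l)" for x l
  have "\<exists>l. ok x l \<and> closed x l" for x
  proof -
    \<comment> \<open>The search succeeds: a longest duplicate-free justified list is closed, since
      a missing consequence could be put in front. The size of the universe bounds the
      lengths.\<close>
    have "\<exists>l. (ok x l \<and> distinct l) \<and> (\<forall>m. ok x m \<and> distinct m \<longrightarrow> length m \<le> length l)"
    proof (rule ex_has_greatest_nat[of "\<lambda>l. ok x l \<and> distinct l" "[]" length "Suc (card (set (U x)))"])
      show "\<forall>m. ok x m \<and> distinct m \<longrightarrow> length m < Suc (card (set (U x)))"
        using ok_U by (metis List.finite_set card_mono distinct_card less_Suc_eq_le)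
    qed (simp add: ok_Nil)
    then obtain l where l: "ok x l" "distinct l" and max: "\<And>m. ok x m \<Longrightarrow> distinct m \<Longrightarrow> length m \<le> length l"
      by blast
    have "closed x l"
      unfolding closed_def
    proof (intro ballI impI, rule ccontr)
      fix y assume "y \<in> set (U x)" "J x y (set l)" "y \<notin> set l"
      then show False using max[of "y # l"] l by (simp add: ok_Cons)
    qed
    then show ?thesis using l by blast
  qed
  moreover have "dec (\<lambda>p. ok (fst p) (snd p) \<and> closed (fst p) (snd p))"
    unfolding ok_def closed_def by (intro cmp_intros dec3[of "\<lambda>x y l. J x y (set l)", OF J] cmp_comp[OF U])
  ultimately obtain f where "cmp f" "\<And>x. ok x (f x) \<and> closed x (f x)"
    using cmp_search[of "\<lambda>x l. ok x l \<and> closed x l"] by blast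
  then show thesis
    using that[of f] ok_U least unfolding closed_def by blast
qed

section \<open>Matches and homomorphisms\<close>

definition matches :: "dinst \<Rightarrow> (nat \<Rightarrow> dterm) \<Rightarrow> atom set \<Rightarrow> bool" where
  "matches M g A \<longleftrightarrow> (\<forall>a\<in>A. (fst a, map g (snd a)) \<in> M)"

lemma sat_tgd_matches:
  "sat_tgd M \<sigma> \<longleftrightarrow> (\<forall>g. matches M g (body \<sigma>) \<longrightarrow>
     (\<exists>g'. (\<forall>x\<in>frontier \<sigma>. g' x = g x) \<and> matches M g' (head \<sigma>)))"
  by (simp add: sat_tgd_def matches_def case_prod_beta)

lemma cq_ans_matches:
  "cq_ans M q c \<longleftrightarrow> (\<exists>g. matches M g (snd q) \<and> map g (fst q) = map Cst c)"
  by (simp add: cq_ans_def matches_def case_prod_beta)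

lemma mem_avars_iff: "x \<in> avars A \<longleftrightarrow> (\<exists>a\<in>A. x \<in> set (snd a))"
  by (force simp: avars_def)

lemma avars_Un [simp]: "avars (A \<union> B) = avars A \<union> avars B"
  by (auto simp: mem_avars_iff)

lemma finite_avars: "finite A \<Longrightarrow> finite (avars A)"
  by (force simp: avars_def)

lemma matches_cong: "(\<And>x. x \<in> avars A \<Longrightarrow> g x = h x) \<Longrightarrow> matches M g A \<longleftrightarrow> matches M h A"
  unfolding matches_def mem_avars_iff
  by (intro ball_cong refl arg_cong[of _ _ "\<lambda>f. f \<in> M"]) auto

lemma matches_Un: "matches M g (A \<union> B) \<longleftrightarrow> matches M g A \<and> matches M g B"
  by (auto simp: matches_def)

lemma matches_hom:
  assumes "matches N g A" "\<And>p ts. (p, ts) \<in> N \<Longrightarrow> (p, map h ts) \<in> M"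
  shows "matches M (h \<circ> g) A"
  using assms by (fastforce simp: matches_def)

lemma constant_list:
  assumes "set us \<subseteq> Cst ` B"
  shows "\<exists>t. set t \<subseteq> B \<and> us = map Cst t"
  using assms
proof (induction us)
  case (Cons u us)
  then obtain t c where "set t \<subseteq> B" "us = map Cst t" "c \<in> B" "u = Cst c" by auto
  then show ?case by (intro exI[of _ "c # t"]) simp
qed simp

lemma certainD:
  "certain D \<Sigma> q c \<Longrightarrow> db_inst D \<subseteq> M \<Longrightarrow> models M \<Sigma> \<Longrightarrow> cq_ans M q c"
  by (simp add: certain_def)

lemma certain_mono: "certain D \<Sigma> q c \<Longrightarrow> D \<subseteq> D' \<Longrightarrow> certain D' \<Sigma> q c"
  unfolding certain_def db_inst_def by (meson image_mono order_trans)

section \<open>Renaming of predicates\<close>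

text \<open>Renamed atoms hold in \<open>N\<close> iff the original ones hold in the preimage
  \<open>?v N\<close>. By injectivity every instance is such a preimage, so both sides range over
  the same instances.\<close>

lemma certain_rename:
  assumes inj: "inj f" and fixed: "\<And>\<tau> a. \<tau> \<in> \<Sigma> \<Longrightarrow> a \<in> body \<tau> \<union> head \<tau> \<Longrightarrow> f (fst a) = fst a"
  shows "certain (map_prod f id ` D) \<Sigma> (y, map_prod f id ` Q) c \<longleftrightarrow> certain D \<Sigma> (y, Q) c"
proof -
  let ?v = "\<lambda>N. {a :: nat \<times> dterm list. map_prod f id a \<in> N}"
  have m: "matches N g (map_prod f id ` A) \<longleftrightarrow> matches (?v N) g A" for N g A
    by (auto simp: matches_def)
  have im: "map_prod f id ` (body \<tau>) = body \<tau>" "map_prod f id ` (head \<tau>) = head \<tau>" if "\<tau> \<in> \<Sigma>" for \<tau>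
  proof -
    have "map_prod f id a = a" if "a \<in> body \<tau> \<union> head \<tau>" for a
      using fixed[OF \<open>\<tau> \<in> \<Sigma>\<close> that] by (cases a) auto
    then show "map_prod f id ` (body \<tau>) = body \<tau>" "map_prod f id ` (head \<tau>) = head \<tau>"
      by (auto simp: image_iff)
  qed
  have mod: "models N \<Sigma> \<longleftrightarrow> models (?v N) \<Sigma>" for N
    unfolding models_def sat_tgd_matches m[symmetric] using im by simp
  have ans: "cq_ans N (y, map_prod f id ` Q) c \<longleftrightarrow> cq_ans (?v N) (y, Q) c" for N
    by (simp add: cq_ans_matches m)
  have db: "db_inst (map_prod f id ` D) \<subseteq> N \<longleftrightarrow> db_inst D \<subseteq> ?v N" for N
    by (auto simp: db_inst_def image_subset_iff)
  have surj: "\<exists>N. ?v N = M" for M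
    using inj by (intro exI[of _ "map_prod f id ` M"]) (auto dest: injD[OF inj])
  have all: "(\<forall>N. P (?v N)) \<longleftrightarrow> (\<forall>M. P M)" for P
    by (metis surj)
  have "certain (map_prod f id ` D) \<Sigma> (y, map_prod f id ` Q) c \<longleftrightarrow>
      (\<forall>N. db_inst D \<subseteq> ?v N \<longrightarrow> models (?v N) \<Sigma> \<longrightarrow> cq_ans (?v N) (y, Q) c)"
    unfolding certain_def db ans using mod by blast
  also have "\<dots> \<longleftrightarrow> certain D \<Sigma> (y, Q) c"
    unfolding certain_def by (rule all)
  finally show ?thesis .
qed

section \<open>The Skolem chase\<close>

datatype skterm = SCst nat | SNul nat nat "skterm list"

instance skterm :: countable
  by countable_datatype

primrec skterm_hom :: "(nat \<Rightarrow> nat \<Rightarrow> dterm list \<Rightarrow> dterm) \<Rightarrow> skterm \<Rightarrow> dterm" where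
  "skterm_hom F (SCst c) = Cst c"
| "skterm_hom F (SNul i z ts) = F i z (map (skterm_hom F) ts)"

text \<open>Skolem terms can be coded injectively by nulls, which keeps the chase inside \<^typ>\<open>dterm\<close>.\<close>
lemma skolem_nulls:
  obtains nul :: "nat \<Rightarrow> nat \<Rightarrow> dterm list \<Rightarrow> dterm"
  where "\<And>i z ts c. nul i z ts \<noteq> Cst c"
    and "\<And>i z ts i' z' ts'. nul i z ts = nul i' z' ts' \<Longrightarrow> i = i' \<and> z = z'"
    and "\<And>F. \<exists>h. (\<forall>c. h (Cst c) = Cst c) \<and> (\<forall>i z ts. h (nul i z ts) = F i z (map h ts))"
proof -
  \<comment> \<open>Constants stay constants; only terms headed by \<open>SNul\<close> become nulls,
    numbered by countability.\<close>
  define emb where "emb t = (case t of SCst c \<Rightarrow> Cst c | SNul i z ts \<Rightarrow> Nul (to_nat t))" for t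
  have "inj emb"
    by (auto simp: inj_def emb_def split: skterm.splits)
  then have inv: "inv emb (emb t) = t" for t by simp
  have invC: "inv emb (Cst c) = SCst c" for c
    using inv[of "SCst c"] by (simp add: emb_def)
  \<comment> \<open>Arguments outside the range of \<open>emb\<close> are read as some Skolem term,
    so injectivity is claimed only in \<open>i\<close> and \<open>z\<close>. The equation for
    \<open>h\<close> holds for all \<open>ts\<close>, since \<open>h\<close> reads terms through the
    same inverse.\<close>
  define nul where "nul i z ts = emb (SNul i z (map (inv emb) ts))" for i z ts
  show thesis
  proof (rule that[of nul])
    show "nul i z ts \<noteq> Cst c" for i z ts c
      by (simp add: nul_def emb_def)
    show "i = i' \<and> z = z'" if "nul i z ts = nul i' z' ts'" for i z ts i' z' ts'
      using that inv unfolding nul_def by (metis skterm.inject(2))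
    show "\<exists>h. (\<forall>c. h (Cst c) = Cst c) \<and> (\<forall>i z ts. h (nul i z ts) = F i z (map h ts))" for F
      by (rule exI[of _ "skterm_hom F \<circ> inv emb"]) (simp add: invC nul_def inv)
  qed
qed

text \<open>The nulls of the semi-oblivious chase: they depend on the rule index, the variable and
  the frontier values only.\<close>

definition skolem :: "(nat \<Rightarrow> nat \<Rightarrow> dterm list \<Rightarrow> dterm) \<Rightarrow> nat \<Rightarrow> tgd \<Rightarrow> (nat \<Rightarrow> dterm) \<Rightarrow> nat \<Rightarrow> dterm" where
  "skolem nul i \<tau> g x =
     (if x \<in> frontier \<tau> then g x else nul i x (map g (sorted_list_of_set (frontier \<tau>))))"

inductive_set chase :: "(nat \<Rightarrow> nat \<Rightarrow> dterm list \<Rightarrow> dterm) \<Rightarrow> atom set \<Rightarrow> tgd list \<Rightarrow> dinst"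
  for nul D T where
  db: "(p, cs) \<in> D \<Longrightarrow> (p, map Cst cs) \<in> chase nul D T"
| step: "i < length T \<Longrightarrow> (\<forall>a\<in>body (T ! i). (fst a, map g (snd a)) \<in> chase nul D T) \<Longrightarrow>
    (p, xs) \<in> head (T ! i) \<Longrightarrow> (p, map (skolem nul i (T ! i) g) xs) \<in> chase nul D T"

lemma db_subset_chase: "db_inst D \<subseteq> chase nul D T"
  by (auto simp: db_inst_def intro: chase.db)

lemma chase_models: "models (chase nul D T) (set T)"
  unfolding models_def sat_tgd_matches
proof (intro ballI allI impI)
  fix \<tau> g assume "\<tau> \<in> set T" and g: "matches (chase nul D T) g (body \<tau>)"
  then obtain i where i: "i < length T" "T ! i = \<tau>"
    by (auto simp: in_set_conv_nth)
  have "matches (chase nul D T) (skolem nul i \<tau> g) (head \<tau>)"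
    using chase.step[OF i(1), of g nul D] g i(2) unfolding matches_def by auto
  moreover have "\<forall>x\<in>frontier \<tau>. skolem nul i \<tau> g x = g x"
    by (simp add: skolem_def)
  ultimately show "\<exists>g'. (\<forall>x\<in>frontier \<tau>. g' x = g x) \<and> matches (chase nul D T) g' (head \<tau>)"
    by blast
qed

text \<open>The homomorphism is defined by recursion on Skolem terms, sending each null to a witness
  supplied by \<open>M\<close>.\<close>

lemma chase_universal:
  assumes rec: "\<And>F. \<exists>h. (\<forall>c. h (Cst c) = Cst c) \<and> (\<forall>i z ts. h (nul i z ts) = F i z (map h ts))"
    and fin: "\<And>\<tau>. \<tau> \<in> set T \<Longrightarrow> finite (frontier \<tau>)"
    and M: "db_inst D \<subseteq> M" "models M (set T)"
  obtains h where "\<And>c. h (Cst c) = Cst c" "\<And>p ts. (p, ts) \<in> chase nul D T \<Longrightarrow> (p, map h ts) \<in> M"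
proof -
  define fl where "fl i = sorted_list_of_set (frontier (T ! i))" for i
  \<comment> \<open>The chosen assignment depends only on the rule and the frontier values, the data
    a null carries, so all nulls of one rule application receive values from the same
    assignment.\<close>
  define G where "G i us = (SOME g'. map g' (fl i) = us \<and> matches M g' (head (T ! i)))" for i us
  obtain h where h: "\<And>c. h (Cst c) = Cst c" "\<And>i z ts. h (nul i z ts) = G i (map h ts) z"
    using rec[of "\<lambda>i z us. G i us z"] by blast
  have "(p, map h ts) \<in> M" if "(p, ts) \<in> chase nul D T" for p ts
    using that
  proof (induction rule: chase.induct)
    case (db p cs)
    then have "(p, map Cst cs) \<in> M" using M(1) by (auto simp: db_inst_def)
    then show ?case by (simp add: comp_def h)
  next
    case (step i g p xs)
    let ?t = "T ! i"
    have t: "?t \<in> set T" using step.hyps by simp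
    have "matches M (h \<circ> g) (body ?t)"
      using step.IH by (simp add: matches_def)
    then obtain g' where g': "\<forall>x\<in>frontier ?t. g' x = (h \<circ> g) x" "matches M g' (head ?t)"
      using M(2) t unfolding models_def sat_tgd_matches by blast
    define us where "us = map (h \<circ> g) (fl i)"
    have "map g' (fl i) = us \<and> matches M g' (head ?t)"
      using g' fin[OF t] by (simp add: us_def fl_def)
    then have G: "map (G i us) (fl i) = us" "matches M (G i us) (head ?t)"
      unfolding G_def by (metis (mono_tags, lifting) someI_ex)+
    have "h (skolem nul i ?t g x) = G i us x" for x
    proof (cases "x \<in> frontier ?t")
      case True
      then have "x \<in> set (fl i)" using fin[OF t] by (simp add: fl_def)
      then have "G i us x = (h \<circ> g) x" using G(1) unfolding us_def by simp
      then show ?thesis using True by (simp add: skolem_def)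
    next
      case False
      then show ?thesis by (simp add: skolem_def h us_def fl_def)
    qed
    then have "map h (map (skolem nul i ?t g) xs) = map (G i us) xs" by simp
    moreover have "(p, map (G i us) xs) \<in> M"
      using G(2) step.hyps unfolding matches_def by (metis fst_conv snd_conv)
    ultimately show ?case by (simp only:)
  qed
  with h(1) show thesis using that by blast
qed

section \<open>Correctness of the dyadic decomposition\<close>

abbreviation bridge_list :: "ontology \<Rightarrow> tgd \<Rightarrow> nat list" where
  "bridge_list \<Sigma> \<sigma> \<equiv> sorted_list_of_set (bridge \<Sigma> \<sigma>)"

abbreviation s_query :: "ontology \<Rightarrow> tgd \<Rightarrow> cq" where
  "s_query \<Sigma> \<sigma> \<equiv> (bridge_list \<Sigma> \<sigma>, s_atoms \<Sigma> \<sigma>)"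

section \<open>Splitting a rule body along its bridge\<close>

lemma body_split: "body \<sigma> = p_atoms \<Sigma> \<sigma> \<union> s_atoms \<Sigma> \<sigma>"
  by (auto simp: s_atoms_def p_atoms_def)

lemma s_atom_harmful_frontier:
  assumes "x \<in> avars (s_atoms \<Sigma> \<sigma>)" "x \<in> frontier \<sigma>"
  shows "\<not> harmful \<Sigma> \<sigma> x"
proof
  assume "harmful \<Sigma> \<sigma> x"
  then have "dangerous \<Sigma> \<sigma> x" using assms(2) by (simp add: dangerous_def)
  then show False
    using assms(1) by (auto simp: mem_avars_iff s_atoms_def p_atoms_def intro: problematic.dang)
qed

lemma harmless_iff: "harmless \<Sigma> \<sigma> x \<longleftrightarrow> x \<in> avars (body \<sigma>) \<and> \<not> harmful \<Sigma> \<sigma> x"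
  by (auto simp: harmless_def harmful_def)

text \<open>A harmful variable shared with a problematic atom would make the s-atom problematic too;
  variables in \<open>HF\<close> are harmless by definition.\<close>

lemma bridge_harmless: "x \<in> bridge \<Sigma> \<sigma> \<Longrightarrow> harmless \<Sigma> \<sigma> x"
proof -
  assume x: "x \<in> bridge \<Sigma> \<sigma>"
  have "\<not> harmful \<Sigma> \<sigma> x" if "x \<in> avars (p_atoms \<Sigma> \<sigma>)" "x \<in> avars (s_atoms \<Sigma> \<sigma>)"
    using that by (auto simp: mem_avars_iff s_atoms_def p_atoms_def intro: problematic.share)
  then show ?thesis
    using x body_split[of \<sigma> \<Sigma>] by (auto simp: bridge_def HF_def harmless_iff)
qed

text \<open>Ensures that replacing the s-atoms by the auxiliary atom loses no frontier
  variable.\<close>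

lemma frontier_s_bridge: "x \<in> frontier \<sigma> \<Longrightarrow> x \<in> avars (s_atoms \<Sigma> \<sigma>) \<Longrightarrow> x \<in> bridge \<Sigma> \<sigma>"
  using s_atom_harmful_frontier[of x \<Sigma> \<sigma>] by (auto simp: bridge_def HF_def harmless_iff frontier_def)

lemma bridge_subset: "bridge \<Sigma> \<sigma> \<subseteq> avars (body \<sigma>)"
  using bridge_harmless harmless_iff by blast

lemma body_main: "body (main_tgd \<Sigma> \<sigma>) = insert (aux_pred \<Sigma> \<sigma>, bridge_list \<Sigma> \<sigma>) (p_atoms \<Sigma> \<sigma>)"
  and head_main: "head (main_tgd \<Sigma> \<sigma>) = head \<sigma>"
  by (simp_all add: main_tgd_def body_def head_def)

lemma inj_enc_atom: "inj enc_atom"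
  by (auto simp: inj_def enc_atom_def list_encode_eq)

lemma enc_tgdl_eq: "enc_tgdl r = enc_tgdl s \<longleftrightarrow> r = s"
  by (auto simp: enc_tgdl_def enc_atoms_def list_encode_eq inj_map_eq_map[OF inj_enc_atom] prod_eq_iff)

text \<open>Finiteness makes \<open>sorted_list_of_set\<close> a faithful enumeration and the
  maximum in \<open>aux_pred\<close> an upper bound.\<close>

locale finite_ontology =
  fixes \<Sigma> :: ontology
  assumes finite_rules: "finite \<Sigma>"
    and finite_body: "\<sigma> \<in> \<Sigma> \<Longrightarrow> finite (body \<sigma>)"
    and finite_head: "\<sigma> \<in> \<Sigma> \<Longrightarrow> finite (head \<sigma>)"
begin

lemma finite_bridge: "\<sigma> \<in> \<Sigma> \<Longrightarrow> finite (bridge \<Sigma> \<sigma>)"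
  using finite_subset[OF bridge_subset] finite_avars finite_body by blast

lemma set_bridge_list: "\<sigma> \<in> \<Sigma> \<Longrightarrow> set (bridge_list \<Sigma> \<sigma>) = bridge \<Sigma> \<sigma>"
  by (simp add: finite_bridge)

lemma pred_less_aux:
  assumes "\<sigma> \<in> \<Sigma>" "a \<in> body \<sigma> \<union> head \<sigma>"
  shows "fst a < aux_pred \<Sigma> \<tau>"
proof -
  have "fst a \<le> Max (insert 0 (fst ` (\<Union>\<tau>\<in>\<Sigma>. body \<tau> \<union> head \<tau>)))"
    using assms finite_rules finite_body finite_head by (intro Max_ge) auto
  then show ?thesis by (simp add: aux_pred_def)
qed

text \<open>\<open>enc_tgdl\<close> is injective, and sorted lists determine the finite body and
  head.\<close>

lemma aux_pred_inj:
  assumes "\<sigma> \<in> \<Sigma>" "\<tau> \<in> \<Sigma>" "aux_pred \<Sigma> \<sigma> = aux_pred \<Sigma> \<tau>"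
  shows "\<sigma> = \<tau>"
proof -
  have "sorted_list_of_set (body \<sigma>) = sorted_list_of_set (body \<tau>)"
    "sorted_list_of_set (head \<sigma>) = sorted_list_of_set (head \<tau>)"
    using assms(3) by (simp_all add: aux_pred_def enc_tgdl_eq)
  then have "body \<sigma> = body \<tau>" "head \<sigma> = head \<tau>"
    using assms(1,2) finite_body finite_head by (metis set_sorted_list_of_set)+
  then show ?thesis by (simp add: body_def head_def prod_eq_iff)
qed

lemma frontier_main:
  assumes "\<sigma> \<in> \<Sigma>"
  shows "frontier (main_tgd \<Sigma> \<sigma>) = frontier \<sigma>"
proof -
  have "avars (body (main_tgd \<Sigma> \<sigma>)) = bridge \<Sigma> \<sigma> \<union> avars (p_atoms \<Sigma> \<sigma>)"
    by (simp add: avars_def body_main set_bridge_list[OF assms])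
  moreover have "avars (body \<sigma>) = avars (p_atoms \<Sigma> \<sigma>) \<union> avars (s_atoms \<Sigma> \<sigma>)"
    using body_split[of \<sigma> \<Sigma>] by (metis avars_Un)
  ultimately show ?thesis
    using frontier_s_bridge[of _ \<sigma> \<Sigma>] bridge_subset[of \<Sigma> \<sigma>]
    by (auto simp: frontier_def head_main)
qed

lemma finite_frontier: "\<sigma> \<in> \<Sigma> \<Longrightarrow> finite (frontier \<sigma>)"
  by (simp add: frontier_def finite_body finite_avars)

section \<open>Models of the ontology versus models of its main part\<close>

definition no_aux :: "(nat \<times> 'a) set \<Rightarrow> bool" where
  "no_aux A \<longleftrightarrow> (\<forall>a\<in>A. fst a \<notin> aux_pred \<Sigma> ` \<Sigma>)"

lemma no_aux_rule: "\<sigma> \<in> \<Sigma> \<Longrightarrow> no_aux (body \<sigma>)" "\<sigma> \<in> \<Sigma> \<Longrightarrow> no_aux (head \<sigma>)"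
  unfolding no_aux_def using pred_less_aux by (metis UnI1 UnI2 imageE less_irrefl)+

lemma no_aux_subset: "no_aux B \<Longrightarrow> A \<subseteq> B \<Longrightarrow> no_aux A"
  by (auto simp: no_aux_def)

text \<open>The model of \<^term>\<open>main_ont \<Sigma>\<close> obtained from a model of \<^term>\<open>\<Sigma>\<close> by reinterpreting each
  auxiliary predicate as the answers to its defining query.\<close>
definition aux_expansion :: "dinst \<Rightarrow> dinst" where
  "aux_expansion M = {a \<in> M. fst a \<notin> aux_pred \<Sigma> ` \<Sigma>} \<union>
     {(aux_pred \<Sigma> \<sigma>, map g (bridge_list \<Sigma> \<sigma>)) | \<sigma> g. \<sigma> \<in> \<Sigma> \<and> matches M g (s_atoms \<Sigma> \<sigma>)}"

lemma matches_aux_expansion: "no_aux A \<Longrightarrow> matches (aux_expansion M) g A \<longleftrightarrow> matches M g A"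
  by (fastforce simp: matches_def aux_expansion_def no_aux_def)

lemma no_aux_atoms:
  "\<sigma> \<in> \<Sigma> \<Longrightarrow> no_aux (p_atoms \<Sigma> \<sigma>)" "\<sigma> \<in> \<Sigma> \<Longrightarrow> no_aux (s_atoms \<Sigma> \<sigma>)"
  using no_aux_subset[OF no_aux_rule(1)] body_split by blast+

text \<open>Matches of the p-atoms and of the s-atoms that agree on the bridge glue to a match of
  the whole body.\<close>

lemma models_aux_expansion:
  assumes "models M \<Sigma>"
  shows "models (aux_expansion M) (main_ont \<Sigma>)"
  unfolding models_def main_ont_def sat_tgd_matches
proof (intro ballI allI impI)
  fix \<tau> g assume "\<tau> \<in> main_tgd \<Sigma> ` \<Sigma>" and g: "matches (aux_expansion M) g (body \<tau>)"
  then obtain \<sigma> where s: "\<sigma> \<in> \<Sigma>" and t: "\<tau> = main_tgd \<Sigma> \<sigma>" by blast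
  have "(aux_pred \<Sigma> \<sigma>, map g (bridge_list \<Sigma> \<sigma>)) \<in> aux_expansion M"
    using g by (simp add: t body_main matches_def)
  \<comment> \<open>An atom with this predicate stems from the second part of the expansion, and
    \<open>aux_pred_inj\<close> identifies its rule.\<close>
  then obtain g2 where g2: "map g (bridge_list \<Sigma> \<sigma>) = map g2 (bridge_list \<Sigma> \<sigma>)"
    "matches M g2 (s_atoms \<Sigma> \<sigma>)"
    using s aux_pred_inj unfolding aux_expansion_def by fastforce
  then have eq: "g x = g2 x" if "x \<in> bridge \<Sigma> \<sigma>" for x
    using that set_bridge_list[OF s] by simp
  have gp: "matches M g (p_atoms \<Sigma> \<sigma>)"
    using g matches_aux_expansion[OF no_aux_atoms(1)[OF s]] by (simp add: t body_main matches_def)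
  \<comment> \<open>Variables common to both parts lie in the bridge, where \<open>g\<close> and
    \<open>g2\<close> agree, so preferring \<open>g\<close> does not disturb the s-atoms.\<close>
  define h where "h x = (if x \<in> avars (p_atoms \<Sigma> \<sigma>) then g x else g2 x)" for x
  have "matches M h (p_atoms \<Sigma> \<sigma>)"
    using gp matches_cong[of "p_atoms \<Sigma> \<sigma>" h g M] by (simp add: h_def)
  moreover have "matches M h (s_atoms \<Sigma> \<sigma>)"
    using g2(2) eq matches_cong[of "s_atoms \<Sigma> \<sigma>" h g2 M] by (simp add: h_def bridge_def)
  ultimately have "matches M h (body \<sigma>)"
    using body_split[of \<sigma> \<Sigma>] by (simp add: matches_Un)
  then obtain g' where g': "\<forall>x\<in>frontier \<sigma>. g' x = h x" "matches M g' (head \<sigma>)"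
    using assms s unfolding models_def sat_tgd_matches by blast
  have "h x = g x" if "x \<in> frontier \<sigma>" for x
  proof (cases "x \<in> avars (p_atoms \<Sigma> \<sigma>)")
    case False
    then have "x \<in> avars (s_atoms \<Sigma> \<sigma>)"
      using that body_split[of \<sigma> \<Sigma>] by (auto simp: frontier_def)
    then show ?thesis using frontier_s_bridge[OF that] eq False by (simp add: h_def)
  qed (simp add: h_def)
  then show "\<exists>g'. (\<forall>x\<in>frontier \<tau>. g' x = g x) \<and> matches (aux_expansion M) g' (head \<tau>)"
    using g' matches_aux_expansion[OF no_aux_rule(2)[OF s]]
    by (auto simp: t frontier_main[OF s] head_main)
qed

text \<open>The expansion of any model of \<open>\<Sigma>\<close> yields a closed set
  \<open>T\<close>. Leastness puts \<open>L\<close> inside it, so the expansion is a model of the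
  main part that contains \<open>D\<close> and \<open>L\<close>.\<close>

theorem main_sound:
  assumes least: "\<And>T. (\<And>\<sigma> t. \<sigma> \<in> \<Sigma> \<Longrightarrow> certain (D \<union> T) (main_ont \<Sigma>) (s_query \<Sigma> \<sigma>) t
      \<Longrightarrow> (aux_pred \<Sigma> \<sigma>, t) \<in> T) \<Longrightarrow> L \<subseteq> T"
    and "no_aux D" "no_aux (snd q)"
    and cert: "certain (D \<union> L) (main_ont \<Sigma>) q c"
  shows "certain D \<Sigma> q c"
  unfolding certain_def
proof (intro allI impI)
  fix M assume D: "db_inst D \<subseteq> M" and M: "models M \<Sigma>"
  note M' = models_aux_expansion[OF M]
  \<comment> \<open>The facts of the expansion without nulls, so that \<open>T\<close> can serve as
    part of a database.\<close>
  define T where "T = {(p, t). (p, map Cst t) \<in> aux_expansion M}"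
  have T: "db_inst T \<subseteq> aux_expansion M"
    by (auto simp: T_def db_inst_def)
  have D': "db_inst D \<subseteq> aux_expansion M"
    using D \<open>no_aux D\<close> by (fastforce simp: db_inst_def aux_expansion_def no_aux_def)
  have db_Un: "db_inst (A \<union> B) = db_inst A \<union> db_inst B" for A B
    by (simp add: db_inst_def image_Un)
  have "L \<subseteq> T"
  proof (rule least)
    fix \<sigma> t assume s: "\<sigma> \<in> \<Sigma>" and c: "certain (D \<union> T) (main_ont \<Sigma>) (s_query \<Sigma> \<sigma>) t"
    have "cq_ans (aux_expansion M) (s_query \<Sigma> \<sigma>) t"
      using certainD[OF c _ M'] T D' by (simp add: db_Un)
    then obtain g where "matches M g (s_atoms \<Sigma> \<sigma>)" "map g (bridge_list \<Sigma> \<sigma>) = map Cst t"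
      using matches_aux_expansion[OF no_aux_atoms(2)[OF s]] by (auto simp: cq_ans_matches)
    then have "(aux_pred \<Sigma> \<sigma>, map Cst t) \<in> aux_expansion M"
      using s unfolding aux_expansion_def by (metis (mono_tags, lifting) UnI2 mem_Collect_eq)
    then show "(aux_pred \<Sigma> \<sigma>, t) \<in> T" by (simp add: T_def)
  qed
  then have "db_inst L \<subseteq> db_inst T"
    unfolding db_inst_def by (rule image_mono)
  then have "db_inst (D \<union> L) \<subseteq> aux_expansion M"
    using D' T by (auto simp: db_Un)
  from certainD[OF cert this M'] show "cq_ans M q c"
    using matches_aux_expansion[OF \<open>no_aux (snd q)\<close>] by (simp add: cq_ans_matches)
qed

text \<open>In the chase of \<^term>\<open>main_ont \<Sigma>\<close>, nulls invented for an existential variable stay within the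
  positions affected by it with respect to \<^term>\<open>\<Sigma>\<close>: the atoms dropped from a rule body are
  replaced by an auxiliary atom, and those hold constants only.\<close>
context
  fixes nul :: "nat \<Rightarrow> nat \<Rightarrow> dterm list \<Rightarrow> dterm" and A :: "atom set" and S :: "tgd list"
  assumes nul_Cst: "\<And>i z ts c. nul i z ts \<noteq> Cst c"
    and nul_inj: "\<And>i z ts i' z' ts'. nul i z ts = nul i' z' ts' \<Longrightarrow> i = i' \<and> z = z'"
    and set_S: "set S = \<Sigma>"
begin

section \<open>Positions of nulls in the chase of the main part\<close>

abbreviation mchase :: dinst where
  "mchase \<equiv> chase nul A (map (main_tgd \<Sigma>) S)"

text \<open>Rule heads carry no auxiliary predicate, so such an atom is a database fact.\<close>

lemma aux_in_mchase:
  assumes "(aux_pred \<Sigma> \<sigma>, ts) \<in> mchase" "\<sigma> \<in> \<Sigma>"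
  shows "set ts \<subseteq> Cst ` avars A"
  using assms(1)
proof cases
  case (db cs)
  then show ?thesis by (force simp: mem_avars_iff)
next
  case (step i g xs)
  then have "(aux_pred \<Sigma> \<sigma>, xs) \<in> head (S ! i)" "S ! i \<in> \<Sigma>"
    using set_S by (auto simp: head_main)
  then show ?thesis
    using no_aux_rule(2) assms(2) by (fastforce simp: no_aux_def)
qed

text \<open>Invariant of the chase. The index \<open>i\<close> inside the null leads back, through
  \<open>S ! i\<close>, to the rule that \<open>affected\<close> speaks of.\<close>

definition origin_ok :: "dterm \<Rightarrow> pos \<Rightarrow> bool" where
  "origin_ok t \<pi> \<longleftrightarrow> t \<in> Cst ` avars A \<or>
     (\<exists>i z us. i < length S \<and> t = nul i z us \<and> affected \<Sigma> (S ! i, z) \<pi>)"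

text \<open>\<open>nul_inj\<close> recovers rule index and variable, so one null at several
  positions names the same existential variable for all of them.\<close>

lemma origin_ok_affected:
  "origin_ok (nul i z us) \<pi> \<Longrightarrow> affected \<Sigma> (S ! i, z) \<pi>"
  using nul_Cst nul_inj unfolding origin_ok_def by (metis imageE)

lemma mchase_origin:
  "(p, ts) \<in> mchase \<Longrightarrow> j < length ts \<Longrightarrow> origin_ok (ts ! j) (p, length ts, j)"
proof (induction arbitrary: j rule: chase.induct)
  case (db p cs)
  then show ?case by (force simp: origin_ok_def mem_avars_iff)
next
  case (step i g p xs)
  define \<sigma> where "\<sigma> = S ! i"
  have i: "i < length S" and s: "\<sigma> \<in> \<Sigma>" and T: "map (main_tgd \<Sigma>) S ! i = main_tgd \<Sigma> \<sigma>"
    using step.hyps set_S by (auto simp: \<sigma>_def)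
  have hd: "(p, xs) \<in> head \<sigma>" using step.hyps by (simp add: T head_main)
  have j: "j < length xs" using step.prems by simp
  define x where "x = xs ! j"
  have pos: "(p, length xs, j) \<in> posns (head \<sigma>) x"
    using hd j by (auto simp: posns_def x_def)
  have xh: "x \<in> avars (head \<sigma>)"
    using hd j by (force simp: mem_avars_iff x_def)
  have "origin_ok (skolem nul i (main_tgd \<Sigma> \<sigma>) g x) (p, length xs, j)"
  proof (cases "x \<in> frontier \<sigma>")
    case False
    then have "x \<in> exvars \<sigma>" using xh by (auto simp: frontier_def exvars_def)
    then have "affected \<Sigma> (S ! i, x) (p, length xs, j)"
      using affected.base[OF s _ pos] by (simp add: \<sigma>_def)
    then show ?thesis
      using False i by (auto simp: origin_ok_def skolem_def frontier_main[OF s])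
  next
    case True
    have "(aux_pred \<Sigma> \<sigma>, map g (bridge_list \<Sigma> \<sigma>)) \<in> mchase"
      using step.IH by (simp add: T body_main)
    from aux_in_mchase[OF this s] have bridge: "g y \<in> Cst ` avars A" if "y \<in> bridge \<Sigma> \<sigma>" for y
      using that set_bridge_list[OF s] by auto
    have IH: "origin_ok (g (ys ! l)) (r, length ys, l)" if "(r, ys) \<in> p_atoms \<Sigma> \<sigma>" "l < length ys" for r ys l
      using step.IH that by (fastforce simp: T body_main)
    have "origin_ok (g x) (p, length xs, j)"
    proof (cases "g x \<in> Cst ` avars A")
      case False
      \<comment> \<open>A value that is no constant of \<open>A\<close> keeps \<open>x\<close> out
        of the bridge, hence out of the s-atoms. All body occurrences of \<open>x\<close> thus lie
        in p-atoms, where the induction hypothesis applies.\<close>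
      then have "x \<notin> bridge \<Sigma> \<sigma>" using bridge by blast
      then have ns: "x \<notin> avars (s_atoms \<Sigma> \<sigma>)" using frontier_s_bridge[OF True] by blast
      have ok: "origin_ok (g x) \<pi>" if \<pi>_pos: "\<pi> \<in> posns (body \<sigma>) x" for \<pi>
      proof -
        obtain r ys l where \<pi>: "\<pi> = (r, length ys, l)" "(r, ys) \<in> body \<sigma>" "l < length ys" "ys ! l = x"
          using \<pi>_pos by (auto simp: posns_def)
        then have "(r, ys) \<notin> s_atoms \<Sigma> \<sigma>" using ns by (force simp: mem_avars_iff)
        then show ?thesis using IH[of r ys l] \<pi> body_split[of \<sigma> \<Sigma>] by auto
      qed
      have "x \<in> avars (body \<sigma>)" using True by (simp add: frontier_def)
      then obtain r ys where "(r, ys) \<in> body \<sigma>" "x \<in> set ys"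
        by (auto simp: mem_avars_iff)
      then obtain l where "(r, length ys, l) \<in> posns (body \<sigma>) x"
        by (auto simp: posns_def in_set_conv_nth)
      \<comment> \<open>One occurrence reveals the null; since the term is the same at every
        occurrence, the premise of \<open>affected.step\<close> holds throughout.\<close>
      from ok[OF this] obtain i' z us where n: "i' < length S" "g x = nul i' z us"
        using False by (auto simp: origin_ok_def)
      have "\<forall>\<pi>\<in>posns (body \<sigma>) x. affected \<Sigma> (S ! i', z) \<pi>"
        using ok origin_ok_affected[of i' z us] n(2) by auto
      from affected.step[OF s True pos this] show ?thesis
        using n by (auto simp: origin_ok_def)
    qed (simp add: origin_ok_def)
    then show ?thesis using True by (simp add: skolem_def frontier_main[OF s])
  qed
  then show ?case using j by (simp add: T x_def)
qed

text \<open>A null at \<open>x\<close> would put its existential variable into \<open>aff\<close> of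
  every body position of \<open>x\<close>, contradicting the empty intersection.\<close>

lemma mchase_harmless:
  assumes "matches mchase g (body \<sigma>)" "harmless \<Sigma> \<sigma> x"
  shows "g x \<in> Cst ` avars A"
proof (rule ccontr)
  assume nc: "g x \<notin> Cst ` avars A"
  have ok: "origin_ok (g x) \<pi>" if \<pi>_pos: "\<pi> \<in> posns (body \<sigma>) x" for \<pi>
  proof -
    obtain r ys l where \<pi>: "\<pi> = (r, length ys, l)" "(r, ys) \<in> body \<sigma>" "l < length ys" "ys ! l = x"
      using \<pi>_pos by (auto simp: posns_def)
    then have "(r, map g ys) \<in> mchase" using assms(1) by (force simp: matches_def)
    from mchase_origin[OF this, of l] show ?thesis using \<pi> by simp
  qed
  have "x \<in> avars (body \<sigma>)" using assms(2) by (simp add: harmless_def)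
  then obtain r ys where "(r, ys) \<in> body \<sigma>" "x \<in> set ys"
    by (auto simp: mem_avars_iff)
  then obtain l where "(r, length ys, l) \<in> posns (body \<sigma>) x"
    by (auto simp: posns_def in_set_conv_nth)
  from ok[OF this] obtain i z us where n: "g x = nul i z us"
    using nc by (auto simp: origin_ok_def)
  have "(S ! i, z) \<in> (\<Inter>\<pi>\<in>posns (body \<sigma>) x. aff \<Sigma> \<pi>)"
    using ok origin_ok_affected[of i z us] n by (auto simp: aff_def)
  then show False using assms(2) unfolding harmless_def by blast
qed

end

text \<open>It suffices that the chase \<open>N\<close> is a model of \<open>\<Sigma>\<close>: the
  certain answer then holds in \<open>N\<close> and passes to every model of the main part by
  universality.\<close>

theorem main_complete:
  assumes closed: "\<And>\<sigma> t. \<sigma> \<in> \<Sigma> \<Longrightarrow> set t \<subseteq> avars D \<Longrightarrow> length t = length (bridge_list \<Sigma> \<sigma>) \<Longrightarrow>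
      certain (D \<union> L) (main_ont \<Sigma>) (s_query \<Sigma> \<sigma>) t \<Longrightarrow> (aux_pred \<Sigma> \<sigma>, t) \<in> L"
    and L: "avars L \<subseteq> avars D"
    and cert: "certain D \<Sigma> q c"
  shows "certain (D \<union> L) (main_ont \<Sigma>) q c"
proof (rule skolem_nulls)
  fix nul :: "nat \<Rightarrow> nat \<Rightarrow> dterm list \<Rightarrow> dterm"
  assume nul: "\<And>i z ts c. nul i z ts \<noteq> Cst c"
     "\<And>i z ts i' z' ts'. nul i z ts = nul i' z' ts' \<Longrightarrow> i = i' \<and> z = z'"
     and rec: "\<And>F. \<exists>h. (\<forall>c. h (Cst c) = Cst c) \<and> (\<forall>i z ts. h (nul i z ts) = F i z (map h ts))"
  obtain S where S: "set S = \<Sigma>" using finite_rules finite_list by blast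
  define T where "T = map (main_tgd \<Sigma>) S"
  define N where "N = chase nul (D \<union> L) T"
  have T: "set T = main_ont \<Sigma>" by (simp add: T_def main_ont_def S)
  have fin: "finite (frontier \<tau>)" if "\<tau> \<in> set T" for \<tau>
    using that by (auto simp: T main_ont_def frontier_main finite_frontier)
  \<comment> \<open>The homomorphism out of the chase fixes constants, so it carries answers
    along.\<close>
  have ans: "cq_ans M q' t"
    if M: "db_inst (D \<union> L) \<subseteq> M" "models M (set T)" and q': "cq_ans N q' t" for M q' t
  proof (rule chase_universal[OF rec fin M])
    fix h
    assume h: "\<And>c. h (Cst c) = Cst c" "\<And>p ts. (p, ts) \<in> chase nul (D \<union> L) T \<Longrightarrow> (p, map h ts) \<in> M"
    obtain g where g: "matches N g (snd q')" "map g (fst q') = map Cst t"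
      using q' by (auto simp: cq_ans_matches)
    have "map (h \<circ> g) (fst q') = map h (map g (fst q'))" by simp
    also have "\<dots> = map Cst t" by (simp only: g(2)) (simp add: h(1))
    finally show ?thesis
      using matches_hom[OF g(1)[unfolded N_def] h(2)] by (auto simp: cq_ans_matches)
  qed
  have main: "models N (main_ont \<Sigma>)"
    using chase_models[of nul "D \<union> L" T] by (simp add: N_def T)
  have db: "db_inst (D \<union> L) \<subseteq> N"
    by (simp add: N_def db_subset_chase)
  have "models N \<Sigma>"
    unfolding models_def sat_tgd_matches
  proof (intro ballI allI impI)
    fix \<sigma> g assume s: "\<sigma> \<in> \<Sigma>" and g: "matches N g (body \<sigma>)"
    have "g x \<in> Cst ` avars (D \<union> L)" if "x \<in> bridge \<Sigma> \<sigma>" for x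
      by (rule mchase_harmless[of nul S, OF _ _ S _ bridge_harmless[OF that]])
         (use nul g in \<open>simp_all add: N_def T_def\<close>)
    then have "set (map g (bridge_list \<Sigma> \<sigma>)) \<subseteq> Cst ` avars D"
      using set_bridge_list[OF s] by (auto simp: Un_absorb2[OF L])
    then obtain t where t: "set t \<subseteq> avars D" "map g (bridge_list \<Sigma> \<sigma>) = map Cst t"
      using constant_list by blast
    \<comment> \<open>Restricted to the s-atoms, \<open>g\<close> answers the bridge query;
      universality makes the answer certain, and \<open>closed\<close> supplies the auxiliary fact
      that completes a match of the main rule.\<close>
    have "cq_ans N (s_query \<Sigma> \<sigma>) t"
      using g t(2) body_split[of \<sigma> \<Sigma>] by (auto simp: cq_ans_matches matches_Un)
    then have "certain (D \<union> L) (main_ont \<Sigma>) (s_query \<Sigma> \<sigma>) t"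
      using ans by (simp add: certain_def T)
    moreover have "length t = length (bridge_list \<Sigma> \<sigma>)"
      using t(2) by (metis length_map)
    ultimately have "(aux_pred \<Sigma> \<sigma>, t) \<in> L" using closed[OF s t(1)] by blast
    then have "(aux_pred \<Sigma> \<sigma>, map g (bridge_list \<Sigma> \<sigma>)) \<in> N"
      using db t(2) by (force simp: db_inst_def)
    moreover have "matches N g (p_atoms \<Sigma> \<sigma>)"
      using g body_split[of \<sigma> \<Sigma>] by (auto simp: matches_Un)
    ultimately have "matches N g (body (main_tgd \<Sigma> \<sigma>))"
      by (simp add: matches_def body_main)
    then show "\<exists>g'. (\<forall>x\<in>frontier \<sigma>. g' x = g x) \<and> matches N g' (head \<sigma>)"
      using main s unfolding models_def main_ont_def sat_tgd_matches
      by (metis frontier_main head_main imageI)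
  qed
  moreover have "db_inst D \<subseteq> N" using db by (auto simp: db_inst_def)
  ultimately have "cq_ans N q c" using certainD[OF cert] by blast
  then show ?thesis using ans by (simp add: certain_def T)
qed

end

section \<open>Computing the dyadic decomposition\<close>

type_synonym rule = "atom list \<times> atom list"

definition tgd_of :: "rule \<Rightarrow> tgd" where
  "tgd_of r = (set (fst r), set (snd r))"

lemma body_tgd_of [simp]: "body (tgd_of r) = set (fst r)"
  and head_tgd_of [simp]: "head (tgd_of r) = set (snd r)"
  by (simp_all add: tgd_of_def body_def head_def)

lemma ont_of_eq: "ont_of S = tgd_of ` set S"
  by (simp add: ont_of_def tgd_of_def case_prod_beta)

lemma finite_ontology_ont_of: "finite_ontology (ont_of S)"
  by standard (auto simp: ont_of_eq)

definition var_list :: "atom list \<Rightarrow> nat list" where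
  "var_list A = concat (map snd A)"

lemma set_var_list [simp]: "set (var_list A) = avars (set A)"
  by (auto simp: var_list_def avars_def)

lemma cmp_var_list [cmp_intros]: "cmp A \<Longrightarrow> cmp (\<lambda>x. var_list (A x))"
  unfolding var_list_def by (intro cmp_intros)

lemma dec_avars [cmp_intros]: "cmp v \<Longrightarrow> cmp A \<Longrightarrow> dec (\<lambda>x. v x \<in> avars (set (A x)))"
  unfolding set_var_list[symmetric] by (intro cmp_intros)

definition pos_list :: "atom list \<Rightarrow> nat \<Rightarrow> pos list" where
  "pos_list A v = concat (map (\<lambda>a. map (\<lambda>i. (fst a, length (snd a), i))
     (filter (\<lambda>i. hd (drop i (snd a)) = v) [0..<length (snd a)])) A)"

lemma set_pos_list [simp]: "set (pos_list A v) = posns (set A) v"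
  by (force simp: pos_list_def posns_def hd_drop_conv_nth)

lemma cmp_pos_list [cmp_intros]: "cmp A \<Longrightarrow> cmp v \<Longrightarrow> cmp (\<lambda>x. pos_list (A x) (v x))"
proof (rule cmp2[of pos_list])
  show "cmp (\<lambda>p. pos_list (fst p) (snd p))"
    unfolding pos_list_def by (intro cmp_intros)
qed

lemma posns_nonempty: "x \<in> avars A \<Longrightarrow> \<exists>\<pi>. \<pi> \<in> posns A x"
  by (force simp: mem_avars_iff posns_def in_set_conv_nth)

text \<open>A frontier variable has a body position, so \<open>affected.step\<close> is never
  applied vacuously.\<close>

lemma affected_rule: "affected \<Sigma> e \<pi> \<Longrightarrow> fst e \<in> \<Sigma>"
proof (induction rule: affected.induct)
  case (step \<sigma> x \<pi> e)
  then show ?case using posns_nonempty[of x "body \<sigma>"] by (auto simp: frontier_def)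
qed simp

subsection \<open>Affected positions\<close>

text \<open>Entries \<open>((r, z), \<pi>)\<close> name a rule by its lists, as it is lists that are
  coded; several lists for one TGD receive separate entries.\<close>

definition aff_step :: "rule list \<Rightarrow> (rule \<times> nat) \<times> pos \<Rightarrow> ((rule \<times> nat) \<times> pos) set \<Rightarrow> bool" where
  "aff_step S y A \<longleftrightarrow>
     \<not> snd (fst y) \<in> avars (set (fst (fst (fst y)))) \<and> snd y \<in> posns (set (snd (fst (fst y)))) (snd (fst y)) \<or>
     (\<exists>s\<in>set S. \<exists>x\<in>avars (set (fst s)).
        snd y \<in> posns (set (snd s)) x \<and> (\<forall>\<pi>\<in>posns (set (fst s)) x. (fst y, \<pi>) \<in> A))"

definition aff_univ :: "rule list \<Rightarrow> ((rule \<times> nat) \<times> pos) list" where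
  "aff_univ S = concat (map (\<lambda>r. concat (map (\<lambda>z. concat (map (\<lambda>s. concat (map (\<lambda>x.
     map (\<lambda>\<pi>. ((r, z), \<pi>)) (pos_list (snd s) x)) (var_list (snd s)))) S)) (var_list (snd r)))) S)"

lemma mem_aff_univ: "((r, z), \<pi>) \<in> set (aff_univ S) \<longleftrightarrow> r \<in> set S \<and> z \<in> avars (set (snd r)) \<and>
    (\<exists>s\<in>set S. \<exists>x\<in>avars (set (snd s)). \<pi> \<in> posns (set (snd s)) x)"
proof -
  have "set (aff_univ S) = (\<Union>r\<in>set S. \<Union>z\<in>avars (set (snd r)). \<Union>s\<in>set S. \<Union>x\<in>avars (set (snd s)).
      Pair (r, z) ` posns (set (snd s)) x)"
    by (simp add: aff_univ_def)
  then show ?thesis by (simp only: UN_iff image_iff prod.inject) blast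
qed

lemma posns_avars: "\<pi> \<in> posns A x \<Longrightarrow> x \<in> avars A"
  by (force simp: posns_def mem_avars_iff)

lemma ex_aff_list:
  "\<exists>f. cmp f \<and> (\<forall>S. set (f S) = {((r, z), \<pi>). r \<in> set S \<and> affected (ont_of S) (tgd_of r, z) \<pi>})"
proof (rule cmp_least_fixpoint[of aff_step aff_univ])
  show "dec (\<lambda>p. aff_step (fst p) (fst (snd p)) (set (snd (snd p))))"
    unfolding aff_step_def set_var_list[symmetric] set_pos_list[symmetric] by (intro cmp_intros)
  show "cmp aff_univ"
    unfolding aff_univ_def by (intro cmp_intros)
  show "aff_step S y B" if "aff_step S y A" "A \<subseteq> B" for S y A B
    using that unfolding aff_step_def by blast
  fix f
  assume f: "cmp f" "\<And>S. set (f S) \<subseteq> set (aff_univ S)"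
    "\<And>S y. y \<in> set (aff_univ S) \<Longrightarrow> aff_step S y (set (f S)) \<Longrightarrow> y \<in> set (f S)"
    "\<And>S T. (\<And>y. y \<in> set (aff_univ S) \<Longrightarrow> aff_step S y T \<Longrightarrow> y \<in> T) \<Longrightarrow> set (f S) \<subseteq> T"
  have "set (f S) = {((r, z), \<pi>). r \<in> set S \<and> affected (ont_of S) (tgd_of r, z) \<pi>}" (is "_ = ?T") for S
  proof
    show "set (f S) \<subseteq> ?T"
    proof (rule f(4))
      fix y assume y: "y \<in> set (aff_univ S)" "aff_step S y ?T"
      obtain r z \<pi> where y_eq: "y = ((r, z), \<pi>)" by (metis surj_pair)
      then have r: "r \<in> set S" and z: "z \<in> avars (set (snd r))" using y(1) by (simp_all add: mem_aff_univ)
      from y(2) have "affected (ont_of S) (tgd_of r, z) \<pi>"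
        unfolding aff_step_def
      proof (elim disjE conjE bexE)
        assume "snd (fst y) \<notin> avars (set (fst (fst (fst y))))"
          "snd y \<in> posns (set (snd (fst (fst y)))) (snd (fst y))"
        then show ?thesis
          using r z by (intro affected.base) (auto simp: y_eq ont_of_eq exvars_def)
      next
        fix s x assume s: "s \<in> set S" "x \<in> avars (set (fst s))" "snd y \<in> posns (set (snd s)) x"
          "\<forall>\<pi>\<in>posns (set (fst s)) x. (fst y, \<pi>) \<in> ?T"
        show ?thesis
        proof (rule affected.step)
          show "tgd_of s \<in> ont_of S" using s by (simp add: ont_of_eq)
          show "x \<in> frontier (tgd_of s)" using s posns_avars by (auto simp: frontier_def)
          show "\<pi> \<in> posns (head (tgd_of s)) x" using s by (simp add: y_eq)
          show "\<forall>\<pi>'\<in>posns (body (tgd_of s)) x. affected (ont_of S) (tgd_of r, z) \<pi>'"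
            using s(4) by (simp add: y_eq)
        qed
      qed
      then show "y \<in> ?T" using r by (simp add: y_eq)
    qed
    have "((r, snd e), \<pi>) \<in> set (f S)" if "affected (ont_of S) e \<pi>" "r \<in> set S" "fst e = tgd_of r" for e \<pi> r
      using that
    proof (induction rule: affected.induct)
      case (base \<sigma> z \<pi>)
      then have "z \<in> avars (set (snd r))" "z \<notin> avars (set (fst r))" "\<pi> \<in> posns (set (snd r)) z"
        by (auto simp: exvars_def)
      then show ?case
        using base.prems by (intro f(3)) (auto simp: mem_aff_univ aff_step_def)
    next
      case (step \<sigma> x \<pi> e)
      then obtain s where s: "s \<in> set S" "\<sigma> = tgd_of s" by (auto simp: ont_of_eq)
      have x: "x \<in> avars (set (fst s))" "x \<in> avars (set (snd s))" "\<pi> \<in> posns (set (snd s)) x"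
        using step.hyps s by (auto simp: frontier_def)
      have IH: "((r, snd e), \<pi>') \<in> set (f S)" if "\<pi>' \<in> posns (set (fst s)) x" for \<pi>'
        using step that s by auto
      \<comment> \<open>That \<open>z\<close> is a head variable of \<open>r\<close> is read off an
        entry for a body position of \<open>x\<close>.\<close>
      obtain \<pi>' where "\<pi>' \<in> posns (set (fst s)) x" using posns_nonempty x(1) by blast
      then have "((r, snd e), \<pi>') \<in> set (aff_univ S)" using IH f(2) by blast
      then have "((r, snd e), \<pi>) \<in> set (aff_univ S)" using s x by (auto simp: mem_aff_univ)
      moreover have "aff_step S ((r, snd e), \<pi>) (set (f S))"
        unfolding aff_step_def by (intro disjI2 bexI[of _ s] bexI[of _ x]) (use IH s x in simp_all)
      ultimately show ?case by (rule f(3))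
    qed
    then have "((r, z), \<pi>) \<in> set (f S)" if "r \<in> set S" "affected (ont_of S) (tgd_of r, z) \<pi>" for r z \<pi>
      using that by (metis fst_conv snd_conv)
    then show "?T \<subseteq> set (f S)" by auto
  qed
  with f(1) show ?thesis by blast
qed

text \<open>The fixed-point search gives only existence; choice names one such function.\<close>

definition aff_list :: "rule list \<Rightarrow> ((rule \<times> nat) \<times> pos) list" where
  "aff_list = (SOME f. cmp f \<and>
     (\<forall>S. set (f S) = {((r, z), \<pi>). r \<in> set S \<and> affected (ont_of S) (tgd_of r, z) \<pi>}))"

lemma set_aff_list: "set (aff_list S) = {((r, z), \<pi>). r \<in> set S \<and> affected (ont_of S) (tgd_of r, z) \<pi>}"
  and cmp_aff_list: "cmp aff_list"
  using someI_ex[OF ex_aff_list] unfolding aff_list_def by blast+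

text \<open>The positions of \<open>x\<close> form a nonempty set, so a common existential variable
  occurs in the list and the quantifier over it becomes bounded.\<close>

lemma harmful_aff_list:
  "harmful (ont_of S) (tgd_of r) x \<longleftrightarrow> x \<in> set (var_list (fst r)) \<and>
     (\<exists>y\<in>set (aff_list S). \<forall>\<pi>\<in>set (pos_list (fst r) x). (fst y, \<pi>) \<in> set (aff_list S))"
  (is "?L \<longleftrightarrow> ?R")
proof
  assume h: ?L
  then have x: "x \<in> avars (set (fst r))" by (simp add: harmful_def)
  obtain e where e: "\<And>\<pi>. \<pi> \<in> posns (set (fst r)) x \<Longrightarrow> affected (ont_of S) e \<pi>"
    using h by (auto simp: harmful_def aff_def)
  obtain \<pi> where \<pi>: "\<pi> \<in> posns (set (fst r)) x" using posns_nonempty[OF x] by blast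
  obtain s z where s: "s \<in> set S" "e = (tgd_of s, z)"
    using affected_rule[OF e[OF \<pi>]] by (cases e) (auto simp: ont_of_eq)
  have all: "\<forall>\<pi>\<in>set (pos_list (fst r) x). ((s, z), \<pi>) \<in> set (aff_list S)"
    using e s by (simp add: set_aff_list)
  moreover have "((s, z), \<pi>) \<in> set (aff_list S)" using all \<pi> by simp
  ultimately show ?R using x by force
next
  assume ?R
  then obtain s z where "x \<in> avars (set (fst r))"
    "\<forall>\<pi>\<in>set (pos_list (fst r) x). ((s, z), \<pi>) \<in> set (aff_list S)" by force
  then have "(tgd_of s, z) \<in> (\<Inter>\<pi>\<in>posns (body (tgd_of r)) x. aff (ont_of S) \<pi>)"
    by (simp add: set_aff_list aff_def)
  then show ?L using \<open>x \<in> avars (set (fst r))\<close> unfolding harmful_def by auto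
qed

lemma dec_harmful [cmp_intros]:
  "cmp S \<Longrightarrow> cmp r \<Longrightarrow> cmp v \<Longrightarrow> dec (\<lambda>x. harmful (ont_of (S x)) (tgd_of (r x)) (v x))"
proof (rule dec3[of "\<lambda>S r. harmful (ont_of S) (tgd_of r)"])
  show "dec (\<lambda>p. harmful (ont_of (fst p)) (tgd_of (fst (snd p))) (snd (snd p)))"
    unfolding harmful_aff_list by (intro cmp_intros cmp_comp[OF cmp_aff_list])
qed

subsection \<open>Problematic atoms and the bridge\<close>

definition prob_step :: "rule list \<times> rule \<Rightarrow> atom \<Rightarrow> atom set \<Rightarrow> bool" where
  "prob_step p a A \<longleftrightarrow>
     (\<exists>x\<in>set (snd a). harmful (ont_of (fst p)) (tgd_of (snd p)) x \<and> x \<in> avars (set (snd (snd p)))) \<or>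
     (\<exists>b\<in>A. \<exists>x\<in>set (snd a). x \<in> set (snd b) \<and> harmful (ont_of (fst p)) (tgd_of (snd p)) x)"

lemma ex_p_list:
  "\<exists>f. cmp f \<and> (\<forall>S r. set (f (S, r)) = p_atoms (ont_of S) (tgd_of r))"
proof (rule cmp_least_fixpoint[of prob_step "\<lambda>p. fst (snd p)"])
  show "dec (\<lambda>p. prob_step (fst p) (fst (snd p)) (set (snd (snd p))))"
    unfolding prob_step_def by (intro cmp_intros)
  show "cmp (\<lambda>p :: rule list \<times> rule. fst (snd p))"
    by (intro cmp_intros)
  show "prob_step p a B" if "prob_step p a A" "A \<subseteq> B" for p a A B
    using that unfolding prob_step_def by blast
  fix f
  assume f: "cmp f" "\<And>p. set (f p) \<subseteq> set (fst (snd p))"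
    "\<And>p a. a \<in> set (fst (snd p)) \<Longrightarrow> prob_step p a (set (f p)) \<Longrightarrow> a \<in> set (f p)"
    "\<And>p T. (\<And>a. a \<in> set (fst (snd p)) \<Longrightarrow> prob_step p a T \<Longrightarrow> a \<in> T) \<Longrightarrow> set (f p) \<subseteq> T"
  have "set (f (S, r)) = p_atoms (ont_of S) (tgd_of r)" for S r
  proof
    show "set (f (S, r)) \<subseteq> p_atoms (ont_of S) (tgd_of r)"
    proof (rule f(4))
      fix a assume a: "a \<in> set (fst (snd (S, r)))" "prob_step (S, r) a (p_atoms (ont_of S) (tgd_of r))"
      have "dangerous (ont_of S) (tgd_of r) x"
        if "harmful (ont_of S) (tgd_of r) x" "x \<in> avars (set (snd r))" for x
        using that by (simp add: dangerous_def frontier_def harmful_def)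
      then have "problematic (ont_of S) (tgd_of r) a"
        using a unfolding prob_step_def
        by (auto simp: p_atoms_def intro: problematic.dang problematic.share)
      then show "a \<in> p_atoms (ont_of S) (tgd_of r)"
        using a(1) by (simp add: p_atoms_def)
    qed
    have "a \<in> set (f (S, r))" if "problematic (ont_of S) (tgd_of r) a" for a
      using that
    proof (induction rule: problematic.induct)
      case (dang a x)
      then show ?case
        by (intro f(3)) (auto simp: prob_step_def dangerous_def frontier_def)
    next
      case (share a b x)
      then show ?case
        by (intro f(3)) (auto simp: prob_step_def)
    qed
    then show "p_atoms (ont_of S) (tgd_of r) \<subseteq> set (f (S, r))"
      by (auto simp: p_atoms_def)
  qed
  with f(1) show ?thesis by blast
qed

definition p_list :: "rule list \<times> rule \<Rightarrow> atom list" where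
  "p_list = (SOME f. cmp f \<and> (\<forall>S r. set (f (S, r)) = p_atoms (ont_of S) (tgd_of r)))"

lemma set_p_list [simp]: "set (p_list (S, r)) = p_atoms (ont_of S) (tgd_of r)"
  and cmp_p_list: "cmp p_list"
  using someI_ex[OF ex_p_list] unfolding p_list_def by blast+

lemma cmp_p_list_pair [cmp_intros]: "cmp S \<Longrightarrow> cmp r \<Longrightarrow> cmp (\<lambda>x. p_list (S x, r x))"
  by (intro cmp_comp[OF cmp_p_list] cmp_Pair)

definition s_list :: "rule list \<Rightarrow> rule \<Rightarrow> atom list" where
  "s_list S r = filter (\<lambda>a. a \<notin> set (p_list (S, r))) (fst r)"

lemma set_s_list [simp]: "set (s_list S r) = s_atoms (ont_of S) (tgd_of r)"
  by (auto simp: s_list_def s_atoms_def)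

lemma cmp_s_list [cmp_intros]: "cmp S \<Longrightarrow> cmp r \<Longrightarrow> cmp (\<lambda>x. s_list (S x) (r x))"
proof (rule cmp2[of s_list])
  show "cmp (\<lambda>p. s_list (fst p) (snd p))"
    unfolding s_list_def by (intro cmp_intros)
qed

text \<open>Both parts of the bridge consist of variables of s-atoms, which allows a single filter
  over the body variables.\<close>

lemma bridge_filter:
  "bridge (ont_of S) (tgd_of r) = set (filter (\<lambda>x. x \<in> set (var_list (s_list S r)) \<and>
     (x \<in> set (var_list (p_list (S, r))) \<or>
      x \<in> set (var_list (snd r)) \<and> \<not> harmful (ont_of S) (tgd_of r) x)) (var_list (fst r)))"
  using bridge_subset[of "ont_of S" "tgd_of r"]
  by (auto simp: bridge_def HF_def harmless_iff frontier_def)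

lemma cmp_bridge_list [cmp_intros]:
  "cmp S \<Longrightarrow> cmp r \<Longrightarrow> cmp (\<lambda>x. bridge_list (ont_of (S x)) (tgd_of (r x)))"
proof (rule cmp2[of "\<lambda>S r. bridge_list (ont_of S) (tgd_of r)"])
  show "cmp (\<lambda>p. bridge_list (ont_of (fst p)) (tgd_of (snd p)))"
    unfolding bridge_filter by (intro cmp_intros)
qed

subsection \<open>The main part\<close>

definition max_pred :: "rule list \<Rightarrow> nat" where
  "max_pred S = Max (insert 0 (fst ` (\<Union>\<tau>\<in>ont_of S. body \<tau> \<union> head \<tau>)))"

lemma cmp_max_pred: "cmp max_pred"
proof (rule cmp_graph)
  define preds where "preds S = 0 # map fst (concat (map (\<lambda>r. fst r @ snd r) S))" for S :: "rule list"
  show "dec (\<lambda>p. (\<forall>n\<in>set (preds (fst p)). n \<le> snd p) \<and> snd p \<in> set (preds (fst p)))"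
    unfolding preds_def by (intro cmp_intros)
  fix S m
  have "max_pred S = Max (set (preds S))"
    by (simp add: max_pred_def preds_def ont_of_eq)
  moreover have "m = Max (set (preds S)) \<longleftrightarrow> m \<in> set (preds S) \<and> (\<forall>n\<in>set (preds S). n \<le> m)"
    by (rule eq_Max_iff) (simp_all add: preds_def)
  ultimately show "(\<forall>n\<in>set (preds S). n \<le> m) \<and> m \<in> set (preds S) \<longleftrightarrow> m = max_pred S"
    by (simp add: conj_commute)
qed

lemma map_code_nat [simp]: "map code (xs :: nat list) = xs"
  by (simp add: map_idI)

text \<open>First of the lemmas that identify the prescribed input encoding with
  \<open>code\<close>, linking \<open>cert_eval\<close> to the calculus of \<open>cmp\<close> and
  \<open>dec\<close>.\<close>

lemma enc_atoms_code: "enc_atoms A = code A"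
proof -
  have "enc_atom = code"
    by (simp add: fun_eq_iff enc_atom_def code_prod_def code_list_def)
  then show ?thesis by (simp add: enc_atoms_def code_list_def)
qed

lemma enc_tgdl_code: "enc_tgdl = code"
  by (simp add: fun_eq_iff enc_tgdl_def code_prod_def enc_atoms_code)

lemma aux_pred_code:
  "aux_pred (ont_of S) (tgd_of r) =
     Suc (max_pred S) + code (sorted_list_of_set (set (fst r)), sorted_list_of_set (set (snd r)))"
  by (simp add: aux_pred_def max_pred_def enc_tgdl_code)

lemma cmp_aux_pred [cmp_intros]:
  "cmp S \<Longrightarrow> cmp r \<Longrightarrow> cmp (\<lambda>x. aux_pred (ont_of (S x)) (tgd_of (r x)))"
proof (rule cmp2[of "\<lambda>S r. aux_pred (ont_of S) (tgd_of r)"])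
  show "cmp (\<lambda>p. aux_pred (ont_of (fst p)) (tgd_of (snd p)))"
    unfolding aux_pred_code
    by (intro cmp_plus cmp_Suc cmp_comp[OF cmp_max_pred] cmp_code[THEN iffD2] cmp_intros)
qed

definition main_list :: "rule list \<Rightarrow> rule list" where
  "main_list S = map (\<lambda>r. ((aux_pred (ont_of S) (tgd_of r), bridge_list (ont_of S) (tgd_of r)) #
     p_list (S, r), snd r)) S"

lemma ont_of_main_list: "ont_of (main_list S) = main_ont (ont_of S)"
proof -
  have "ont_of (main_list S) = tgd_of ` set (main_list S)"
    by (rule ont_of_eq)
  also have "\<dots> = (\<lambda>r. main_tgd (ont_of S) (tgd_of r)) ` set S"
    unfolding main_list_def set_map image_image
    by (intro image_cong refl) (simp add: tgd_of_def main_tgd_def head_def)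
  also have "\<dots> = main_tgd (ont_of S) ` (tgd_of ` set S)"
    by (simp add: image_image)
  also have "\<dots> = main_ont (ont_of S)"
    by (simp only: main_ont_def ont_of_eq[symmetric])
  finally show ?thesis .
qed

lemma cmp_main_list [cmp_intros]: "cmp S \<Longrightarrow> cmp (\<lambda>x. main_list (S x))"
proof (rule cmp_comp[of main_list])
  show "cmp main_list"
    unfolding main_list_def by (intro cmp_intros)
qed

text \<open>The auxiliary predicates are fresh for the ontology, but may occur in the database and the
  query; this renaming moves such occurrences out of the way.\<close>
definition rename_pred :: "rule list \<Rightarrow> nat \<Rightarrow> nat" where
  "rename_pred S p = (if p \<le> max_pred S then p
     else p + sum_list (map (\<lambda>r. aux_pred (ont_of S) (tgd_of r)) S))"

definition rename_atoms :: "rule list \<Rightarrow> atom list \<Rightarrow> atom list" where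
  "rename_atoms S A = map (\<lambda>a. (rename_pred S (fst a), snd a)) A"

lemma cmp_rename_atoms [cmp_intros]: "cmp S \<Longrightarrow> cmp A \<Longrightarrow> cmp (\<lambda>x. rename_atoms (S x) (A x))"
proof (rule cmp2[of rename_atoms])
  show "cmp (\<lambda>p. rename_atoms (fst p) (snd p))"
    unfolding rename_atoms_def rename_pred_def by (intro cmp_intros cmp_comp[OF cmp_max_pred])
qed

lemma set_rename_atoms: "set (rename_atoms S A) = map_prod (rename_pred S) id ` set A"
  unfolding rename_atoms_def set_map by (intro image_cong) (auto simp: map_prod_def case_prod_beta)

lemma certain_rename_atoms:
  "certain (set (rename_atoms S D)) (ont_of S) (y, set (rename_atoms S Q)) c \<longleftrightarrow>
     certain (set D) (ont_of S) (y, set Q) c"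
  unfolding set_rename_atoms
proof (rule certain_rename)
  show "inj (rename_pred S)"
    by (auto simp: inj_def rename_pred_def split: if_splits)
  fix \<tau> a assume "\<tau> \<in> ont_of S" "a \<in> body \<tau> \<union> head \<tau>"
  then have "fst a \<in> insert 0 (fst ` (\<Union>\<tau>\<in>ont_of S. body \<tau> \<union> head \<tau>))" by blast
  then have "fst a \<le> max_pred S"
    unfolding max_pred_def by (intro Max_ge) (simp_all add: ont_of_eq)
  then show "rename_pred S (fst a) = fst a" by (simp add: rename_pred_def)
qed

text \<open>Symbols up to \<open>max_pred\<close> lie below all auxiliary ones; the others are
  positive and shifted by the sum of all auxiliary ones, hence end above each.\<close>

lemma rename_atoms_no_aux: "finite_ontology.no_aux (ont_of S) (set (rename_atoms S A))"
proof -
  have "rename_pred S p \<noteq> aux_pred (ont_of S) (tgd_of r)" if "r \<in> set S" for p r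
  proof -
    have "aux_pred (ont_of S) (tgd_of r) \<le> sum_list (map (\<lambda>r. aux_pred (ont_of S) (tgd_of r)) S)"
      using that by (intro member_le_sum_list) auto
    moreover have "max_pred S < aux_pred (ont_of S) (tgd_of r)"
      by (simp add: aux_pred_code)
    ultimately show ?thesis by (simp add: rename_pred_def)
  qed
  then show ?thesis
    unfolding finite_ontology.no_aux_def[OF finite_ontology_ont_of]
    by (auto simp: rename_atoms_def ont_of_eq)
qed

subsection \<open>The reduction\<close>

lemma enc_input_code: "enc_input = code"
  by (auto simp: fun_eq_iff enc_input_def code_prod_def enc_atoms_code enc_tgdl_code)
     (simp_all add: code_list_def)

lemma mem_cert_eval:
  "code ((D, S, q, c) :: input) \<in> cert_eval C \<longleftrightarrow>
     ont_of S \<in> C \<and> certain (set D) (ont_of S) (fst q, set (snd q)) c"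
  by (cases q) (auto simp: cert_eval_def enc_input_code)

text \<open>Applied to a database, \<open>var_list\<close> lists its constants; restricting to
  tuples of these keeps the fixed point finite.\<close>

definition aux_univ :: "atom list \<times> rule list \<Rightarrow> atom list" where
  "aux_univ x = concat (map (\<lambda>r. map (\<lambda>t. (aux_pred (ont_of (snd x)) (tgd_of r), t))
     (List.n_lists (length (bridge_list (ont_of (snd x)) (tgd_of r))) (var_list (fst x)))) (snd x))"

text \<open>The conjunct on \<open>C\<close> makes the step a plain membership question to
  \<open>cert_eval C\<close>; outside \<open>C\<close> nothing is ever added.\<close>

definition aux_step :: "ontology set \<Rightarrow> atom list \<times> rule list \<Rightarrow> atom \<Rightarrow> atom set \<Rightarrow> bool" where
  "aux_step C x a A \<longleftrightarrow> (\<exists>r\<in>set (snd x). fst a = aux_pred (ont_of (snd x)) (tgd_of r) \<and>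
     main_ont (ont_of (snd x)) \<in> C \<and>
     certain (set (fst x) \<union> A) (main_ont (ont_of (snd x))) (s_query (ont_of (snd x)) (tgd_of r)) (snd a))"

lemma aux_step_oracle:
  "aux_step C x a (set l) \<longleftrightarrow> (\<exists>r\<in>set (snd x). fst a = aux_pred (ont_of (snd x)) (tgd_of r) \<and>
     code (fst x @ l, main_list (snd x),
       (bridge_list (ont_of (snd x)) (tgd_of r), s_list (snd x) r), snd a) \<in> cert_eval C)"
  by (simp add: aux_step_def mem_cert_eval ont_of_main_list)

theorem mainTheorem8:
  fixes C :: "ontology set"
  assumes "decidable (cert_eval C)"
  shows "decidable (cert_eval (Dyadic C))"
proof -
  \<comment> \<open>The assumption becomes an oracle for any computably built input.\<close>
  have orc: "dec (\<lambda>x. code (g x) \<in> cert_eval C)" if "cmp g" for g :: "'x::coded \<Rightarrow> input"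
    using dec_comp[OF assms[unfolded decidable_iff_dec], of "\<lambda>x. code (g x)"] that by (simp add: cmp_code)
  show ?thesis
  proof (rule cmp_least_fixpoint[of "aux_step C" aux_univ])
    show "dec (\<lambda>p. aux_step C (fst p) (fst (snd p)) (set (snd (snd p))))"
      unfolding aux_step_oracle by (intro cmp_intros orc)
    show "cmp aux_univ"
      unfolding aux_univ_def by (intro cmp_intros)
    show "aux_step C x a B" if "aux_step C x a A" "A \<subseteq> B" for x a A B
      using that certain_mono[OF _ Un_mono[OF subset_refl]] unfolding aux_step_def by blast
    fix f
    assume f: "cmp f" "\<And>x. set (f x) \<subseteq> set (aux_univ x)"
      "\<And>x a. a \<in> set (aux_univ x) \<Longrightarrow> aux_step C x a (set (f x)) \<Longrightarrow> a \<in> set (f x)"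
      "\<And>x T. (\<And>a. a \<in> set (aux_univ x) \<Longrightarrow> aux_step C x a T \<Longrightarrow> a \<in> T) \<Longrightarrow> set (f x) \<subseteq> T"
    \<comment> \<open>Leastness of \<open>f\<close> feeds \<open>main_sound\<close>, closedness
      feeds \<open>main_complete\<close>. With \<open>main_ont (ont_of S)\<close> in
      \<open>C\<close>, \<open>aux_step\<close> expresses the certain answers themselves.\<close>
    have key: "certain (set D \<union> set (f (D, S))) (main_ont (ont_of S)) (y, set Q) c \<longleftrightarrow>
        certain (set D) (ont_of S) (y, set Q) c"
      if C: "main_ont (ont_of S) \<in> C" and D: "finite_ontology.no_aux (ont_of S) (set D)"
        and Q: "finite_ontology.no_aux (ont_of S) (set Q)" for D S y Q c
    proof -
      interpret finite_ontology "ont_of S" by (rule finite_ontology_ont_of)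
      have univ: "a \<in> set (aux_univ (D, S)) \<longleftrightarrow> (\<exists>r\<in>set S. fst a = aux_pred (ont_of S) (tgd_of r) \<and>
          length (snd a) = length (bridge_list (ont_of S) (tgd_of r)) \<and> set (snd a) \<subseteq> avars (set D))" for a
        by (cases a) (auto simp: aux_univ_def set_n_lists)
      show ?thesis
      proof
        assume c: "certain (set D \<union> set (f (D, S))) (main_ont (ont_of S)) (y, set Q) c"
        show "certain (set D) (ont_of S) (y, set Q) c"
        proof (rule main_sound[OF _ D _ c])
          fix T assume T: "\<And>\<sigma> t. \<sigma> \<in> ont_of S \<Longrightarrow>
            certain (set D \<union> T) (main_ont (ont_of S)) (s_query (ont_of S) \<sigma>) t \<Longrightarrow> (aux_pred (ont_of S) \<sigma>, t) \<in> T"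
          show "set (f (D, S)) \<subseteq> T"
          proof (rule f(4))
            fix a assume "aux_step C (D, S) a T"
            then obtain r where "r \<in> set S" and a: "fst a = aux_pred (ont_of S) (tgd_of r)"
              and "certain (set D \<union> T) (main_ont (ont_of S)) (s_query (ont_of S) (tgd_of r)) (snd a)"
              unfolding aux_step_def by auto
            then have "(aux_pred (ont_of S) (tgd_of r), snd a) \<in> T"
              by (intro T) (simp_all add: ont_of_eq)
            then show "a \<in> T" by (simp flip: a)
          qed
        qed (use Q in simp)
      next
        assume c: "certain (set D) (ont_of S) (y, set Q) c"
        show "certain (set D \<union> set (f (D, S))) (main_ont (ont_of S)) (y, set Q) c"
        proof (rule main_complete[OF _ _ c])
          show "avars (set (f (D, S))) \<subseteq> avars (set D)"
          proof
            fix v assume "v \<in> avars (set (f (D, S)))"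
            then obtain a where a: "a \<in> set (f (D, S))" "v \<in> set (snd a)"
              unfolding mem_avars_iff by blast
            from a(1) have "set (snd a) \<subseteq> avars (set D)"
              using f(2)[of "(D, S)"] univ[of a] by blast
            with a(2) show "v \<in> avars (set D)" by blast
          qed
          fix \<sigma> t assume s: "\<sigma> \<in> ont_of S" "set t \<subseteq> avars (set D)"
            "length t = length (bridge_list (ont_of S) \<sigma>)"
            "certain (set D \<union> set (f (D, S))) (main_ont (ont_of S)) (s_query (ont_of S) \<sigma>) t"
          then obtain r where r: "r \<in> set S" "\<sigma> = tgd_of r" by (auto simp: ont_of_eq)
          show "(aux_pred (ont_of S) \<sigma>, t) \<in> set (f (D, S))"
          proof (rule f(3))
            show "(aux_pred (ont_of S) \<sigma>, t) \<in> set (aux_univ (D, S))"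
              unfolding univ using r s by auto
            show "aux_step C (D, S) (aux_pred (ont_of S) \<sigma>, t) (set (f (D, S)))"
              unfolding aux_step_def using r s C by auto
          qed
        qed
      qed
    qed
    \<comment> \<open>Renaming precedes the fixed point, so auxiliary predicates enter the database
      only through \<open>f\<close>.\<close>
    define red :: "input \<Rightarrow> input" where "red x = (let S = fst (snd x); D = rename_atoms S (fst x) in
        (D @ f (D, S), main_list S, (fst (fst (snd (snd x))), rename_atoms S (snd (fst (snd (snd x))))),
         snd (snd (snd x))))" for x
    have red: "cmp red"
      unfolding red_def Let_def by (intro cmp_intros cmp_comp[OF f(1)])
    \<comment> \<open>Each of the two queries tests membership in \<open>C\<close> itself, so it
      need not be decided beforehand why the ontology is dyadic.\<close>
    have "dec (\<lambda>n. n \<in> cert_eval C \<or> code (red (decode n)) \<in> cert_eval C)"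
      by (intro dec_disj orc cmp_comp[OF red] cmp_decode assms[unfolded decidable_iff_dec])
    moreover have "n \<in> cert_eval (Dyadic C) \<longleftrightarrow> n \<in> cert_eval C \<or> code (red (decode n)) \<in> cert_eval C" for n
    proof -
      obtain D S y Q c where n: "n = code ((D, S, (y, Q), c) :: input)"
        by (metis code_decode prod.collapse)
      have "code (red (D, S, (y, Q), c)) \<in> cert_eval C \<longleftrightarrow>
          main_ont (ont_of S) \<in> C \<and> certain (set D) (ont_of S) (y, set Q) c"
        using key[OF _ rename_atoms_no_aux rename_atoms_no_aux, of S D y Q c]
        by (auto simp: red_def Let_def mem_cert_eval ont_of_main_list certain_rename_atoms)
      then show ?thesis
        by (auto simp: n mem_cert_eval Dyadic_def)
    qed
    ultimately show ?thesis by (simp add: decidable_iff_dec)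
  qed
qed

end
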